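(* Let $\mu_{\mathbf p}$ denote the pushforward to $[0,1]\setminus\mathbb{Q}$, under the continued fraction coding map $\Pi$, of the Bernoulli measure $m_{\mathbf p}$ on $\mathbb{N}^{\mathbb{N}}$ associated to a probability vector $\mathbf p=(p_i)_{i=1}^\infty$. There exists a probability vector $\mathbf p^*$ such that $$\sup_{\mathbf p}\dim\mu_{\mathbf p}=\dim\mu_{\mathbf p^*},$$ where the supremum is over all probability vectors $\mathbf p=(p_i)_{i=1}^\infty$.
   Context: A probability vector is a sequence $\mathbf p=(p_i)_{i=1}^\infty$ with $p_i\ge 0$ and $\sum_{i=1}^\infty p_i=1$. $\mathbb{N}=\{1,2,\ldots\}$. The map $\Pi:\mathbb{N}^{\mathbb{N}}\to[0,1]\setminus\mathbb{Q}$ sends $(a_i)$ to the number with continued fraction expansion $(a_i)$: $$\Pi((a_i))=\cfrac{1}{a_1+\cfrac{1}{a_2+\cfrac{1}{a_3+\ldots}}}.$$ $m_{\mathbf p}$ is the Bernoulli (product) measure on $\mathbb{N}^{\mathbb{N}}$ for which the coordinates are i.i.d. and take the value $i$ with probability $p_i$, and $\mu_{\mathbf p}:=\Pi_*m_{\mathbf p}=m_{\mathbf p}\circ\Pi^{-1}$. For a Borel probability measure $\mu$ supported on $[0,1]$, $\dim(\mu):=\inf\{\dim_H(A):\mu(A)=1\}$, where $\dim_H$ is Hausdorff dimension and $A$ ranges over Borel sets. *)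

theory Defs
  imports "HOL-Probability.Probability"
begin

section \<open>Hausdorff dimension\<close>

text \<open>
  The \<open>s\<close>-th power of the diameter, with the usual conventions that the empty set contributes
  \<open>0\<close> and that \<open>0\<^sup>0 = 1\<close>; the case distinction is needed because
  \<^term>\<open>0 powr (0::real)\<close> is \<open>0\<close>.
\<close>
definition diam_power :: "real \<Rightarrow> 'a::metric_space set \<Rightarrow> ennreal" where
  "diam_power s U =
     (if U = {} then 0 else if s = 0 then 1 else ennreal (diameter U powr s))"

text \<open>
  Boundedness is demanded separately because \<^const>\<open>diameter\<close> is unspecified on unbounded sets.
  Finite covers are included, since members of a cover may be empty.
\<close>
definition hausdorff_premeasure :: "real \<Rightarrow> real \<Rightarrow> 'a::metric_space set \<Rightarrow> ennreal" where
  "hausdorff_premeasure \<delta> s A =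
     (INF U\<in>{U :: nat \<Rightarrow> 'a set.
               A \<subseteq> (\<Union>i. U i) \<and> (\<forall>i. bounded (U i) \<and> diameter (U i) \<le> \<delta>)}.
        \<Sum>i. diam_power s (U i))"

definition hausdorff_measure :: "real \<Rightarrow> 'a::metric_space set \<Rightarrow> ennreal" where
  "hausdorff_measure s A = (SUP \<delta>\<in>{0<..}. hausdorff_premeasure \<delta> s A)"

definition hausdorff_dim :: "'a::metric_space set \<Rightarrow> ennreal" where
  "hausdorff_dim A = (INF s\<in>{s. 0 \<le> s \<and> hausdorff_measure s A = 0}. ennreal s)"

definition measure_dim :: "'a::metric_space measure \<Rightarrow> ennreal" where
  "measure_dim \<mu> = (INF A\<in>{A \<in> sets borel. emeasure \<mu> A = 1}. hausdorff_dim A)"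


section \<open>Continued fraction coding\<close>

text \<open>
  A digit sequence is a function \<open>a\<close> with values in \<open>{1..}\<close>, and its positions are counted from
  \<open>0\<close>: \<open>a n\<close> is the digit usually written \<open>a\<^bsub>n+1\<^esub>\<close>.  Thus
  \<open>cf_trunc a n = 1 / (a 0 + 1 / (a 1 + ... + 1 / a (n - 1)))\<close>.
\<close>
primrec cf_trunc :: "(nat \<Rightarrow> nat) \<Rightarrow> nat \<Rightarrow> real" where
  "cf_trunc a 0 = 0"
| "cf_trunc a (Suc n) = 1 / (real (a 0) + cf_trunc (\<lambda>k. a (Suc k)) n)"

definition cf_coding :: "(nat \<Rightarrow> nat) \<Rightarrow> real" where
  "cf_coding a = lim (\<lambda>n. cf_trunc a n)"


section \<open>Bernoulli measures and their projections\<close>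

text \<open>
  Probability vectors are indexed by \<open>{1, 2, ...}\<close>; the value \<open>p 0\<close> is junk and plays no role in
  any of the definitions.
\<close>
definition prob_vectors :: "(nat \<Rightarrow> real) set" where
  "prob_vectors = {p. (\<forall>i\<ge>1. 0 \<le> p i) \<and> (\<lambda>i. p (Suc i)) sums 1}"

definition digit_measure :: "(nat \<Rightarrow> real) \<Rightarrow> nat measure" where
  "digit_measure p = point_measure {1..} (\<lambda>i. ennreal (p i))"

definition bernoulli_measure :: "(nat \<Rightarrow> real) \<Rightarrow> (nat \<Rightarrow> nat) measure" where
  "bernoulli_measure p = (\<Pi>\<^sub>M n\<in>(UNIV :: nat set). digit_measure p)"

text \<open>The pushforward is regarded as a Borel measure on the whole real line.\<close>
definition cf_measure :: "(nat \<Rightarrow> real) \<Rightarrow> real measure" where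
  "cf_measure p = distr (bernoulli_measure p) borel cf_coding"

lemma space_bernoulli_measure: "space (bernoulli_measure p) = {a. \<forall>n. 1 \<le> a n}"
  by (auto simp: bernoulli_measure_def digit_measure_def space_point_measure space_PiM PiE_def Pi_def)

lemma emeasure_digit_measure:
  assumes "1 \<le> i"
  shows "emeasure (digit_measure p) {i} = ennreal (p i)"
  using assms unfolding digit_measure_def
  by (subst emeasure_point_measure_finite2) auto

lemma prob_space_digit_measure:
  assumes p: "p \<in> prob_vectors"
  shows "prob_space (digit_measure p)"
proof (rule prob_spaceI)
  have nn: "0 \<le> p (Suc i)" for i
    using p by (simp add: prob_vectors_def)
  have s: "(\<lambda>i. p (Suc i)) sums 1"
    using p by (simp add: prob_vectors_def)
  have "emeasure (digit_measure p) (space (digit_measure p))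
      = (\<integral>\<^sup>+ i. ennreal (p i) \<partial>count_space {1..})"
    by (simp add: digit_measure_def point_measure_def emeasure_density space_density
        flip: nn_integral_count_space_indicator)
       (intro nn_integral_cong, simp add: indicator_def)
  also have "\<dots> = (\<integral>\<^sup>+ i. ennreal (p (Suc i)) \<partial>count_space UNIV)"
  proof -
    have "bij_betw Suc UNIV {1..}"
      by (rule bij_betwI[of _ _ _ "\<lambda>n. n - 1"]) auto
    from nn_integral_bij_count_space[OF this, of "\<lambda>i. ennreal (p i)"] show ?thesis
      by simp
  qed
  also have "\<dots> = (\<Sum>i. ennreal (p (Suc i)))"
    by (rule nn_integral_count_space_nat)
  also have "\<dots> = 1"
    using suminf_ennreal2[OF nn sums_summable[OF s]] sums_unique[OF s] by simp
  finally show "emeasure (digit_measure p) (space (digit_measure p)) = 1" .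
qed

lemma prob_space_bernoulli_measure:
  "p \<in> prob_vectors \<Longrightarrow> prob_space (bernoulli_measure p)"
  unfolding bernoulli_measure_def by (intro prob_space_PiM prob_space_digit_measure)

lemma measurable_cf_trunc:
  "(\<lambda>a. cf_trunc (\<lambda>j. a (j + k)) n) \<in> borel_measurable (bernoulli_measure p)"
proof (induction n arbitrary: k)
  case 0
  then show ?case by simp
next
  case (Suc n)
  have "(\<lambda>a. a k) \<in> measurable (bernoulli_measure p) (digit_measure p)"
    unfolding bernoulli_measure_def by (rule measurable_component_singleton) simp
  moreover have "real \<in> borel_measurable (digit_measure p)"
    by (simp add: digit_measure_def)
  ultimately have [measurable]: "(\<lambda>a. real (a k)) \<in> borel_measurable (bernoulli_measure p)"
    by (rule measurable_compose)
  have [measurable]: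
    "(\<lambda>a. cf_trunc (\<lambda>j. a (Suc (j + k))) n) \<in> borel_measurable (bernoulli_measure p)"
    using Suc.IH[of "Suc k"] by simp
  show ?case by simp
qed

lemma measurable_cf_coding: "cf_coding \<in> borel_measurable (bernoulli_measure p)"
  unfolding cf_coding_def
  using measurable_cf_trunc[of 0] by (intro borel_measurable_lim_metric) simp

lemma prob_space_cf_measure: "p \<in> prob_vectors \<Longrightarrow> prob_space (cf_measure p)"
  unfolding cf_measure_def
  by (intro prob_space.prob_space_distr prob_space_bernoulli_measure measurable_cf_coding)

end

theory Submission
  imports Defs
begin

text \<open>
  For a digit sequence \<open>a\<close> with image \<open>x\<close> let \<open>X a = ln (p (a 0)) - 2 * s * ln x\<close> (\<open>dim_potential\<close>). The
  Birkhoff sums of \<open>X\<close> under the shift compare the mass of the cylinders around \<open>x\<close> with the \<open>s\<close>-th power of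
  their length, so the sign of the mean of \<open>X\<close> decides on which side of \<open>s\<close> the dimension lies:
  a positive mean gives dimension at most \<open>s\<close> by covering with cylinders (\<open>measure_dim_le\<close>), a negative
  mean gives dimension at least \<open>s\<close> by mass distribution (\<open>measure_dim_ge\<close>). Both directions need from
  ergodic theory only that Birkhoff sums of a function with negative mean are almost surely bounded
  above, which follows from the maximal ergodic lemma and Kolmogorov's 0-1 law. On the metric side they
  rest on the exact formula \<open>cf_coding_diff\<close> for the distance of two numbers with a common prefix of
  digits.

  The condition "the mean of \<open>X\<close> is at most \<open>0\<close>" is closed. For \<open>s > 1 / 2\<close> the mean of \<open>X\<close> is, up to the
  finite constant \<open>zeta_sum s\<close>, a sum of nonnegative terms (\<open>energy\<close>), and Fatou's lemma makes it lower
  semicontinuous under pointwise convergence of probability vectors (\<open>energy_liminf\<close>). The condition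
  also bounds \<open>\<Sum>i. p i * ln i\<close> uniformly (\<open>suminf_log_digits_le\<close>), so that vectors satisfying it are tight
  and the set of them is compact (\<open>prob_vectors_compact\<close>).

  Let \<open>S\<close> be the supremum of the dimensions. A simple vector on three digits shows \<open>S > 1 / 2\<close>
  (\<open>exists_measure_dim_gt_half\<close>). A maximising sequence eventually satisfies the condition for each
  \<open>s\<close> with \<open>1 / 2 < s < S\<close>, hence so does a limit of a subsequence, and this limit has dimension at
  least \<open>S\<close>.
\<close>

section \<open>The continued fraction coding\<close>

definition digit_shift :: "(nat \<Rightarrow> 'a) \<Rightarrow> nat \<Rightarrow> 'a" where
  "digit_shift a = (\<lambda>k. a (Suc k))"

lemma digit_shift_apply [simp]: "digit_shift a k = a (Suc k)"
  by (simp add: digit_shift_def)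

lemma digit_shift_funpow [simp]: "(digit_shift ^^ n) a k = a (n + k)"
  by (induction n arbitrary: k) auto

lemma digit_shift_case_nat [simp]: "digit_shift (case_nat i a) = a"
  by (auto simp: digit_shift_def)

lemma cf_trunc_Suc_shift: "cf_trunc a (Suc n) = 1 / (real (a 0) + cf_trunc (digit_shift a) n)"
  by (simp add: digit_shift_def)

lemma cf_trunc_bounds:
  assumes "\<forall>k. 1 \<le> a k"
  shows "0 \<le> cf_trunc a n \<and> cf_trunc a n \<le> 1"
  using assms
proof (induction n arbitrary: a)
  case (Suc n)
  have "0 \<le> cf_trunc (digit_shift a) n"
  proof -
    have "\<forall>k. 1 \<le> digit_shift a k" using Suc.prems by simp
    then show ?thesis using Suc.IH by blast
  qed
  moreover have "1 \<le> a 0" using Suc.prems by blast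
  ultimately have "0 \<le> cf_trunc (digit_shift a) n" "1 \<le> real (a 0)" by simp_all
  then show ?case by (simp add: cf_trunc_Suc_shift del: cf_trunc.simps)
qed simp

text \<open>
  The map \<open>x \<mapsto> 1 / (c + x)\<close> alone is not a uniform contraction when \<open>c = 1\<close>. Two steps are:
  they multiply the difference by \<open>1 / (u * v)\<close> with \<open>u = c * (d + x) + 1 \<ge> 2\<close> and \<open>v = c * (d + y) + 1 \<ge> 2\<close>.
\<close>
lemma cf_two_step_contraction:
  fixes c d x y :: real
  assumes "1 \<le> c" "1 \<le> d" "0 \<le> x" "0 \<le> y"
  shows "\<bar>1 / (c + 1 / (d + x)) - 1 / (c + 1 / (d + y))\<bar> \<le> \<bar>x - y\<bar> / 4"
proof -
  define u v where "u = c * (d + x) + 1" and "v = c * (d + y) + 1"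
  have "1 * 1 \<le> c * (d + x)" "1 * 1 \<le> c * (d + y)"
    using assms by (intro mult_mono; simp)+
  then have uv: "2 \<le> u" "2 \<le> v" by (auto simp: u_def v_def)
  then have "2 * 2 \<le> u * v" by (intro mult_mono) auto
  have "1 / (c + 1 / (d + x)) = (d + x) / u" "1 / (c + 1 / (d + y)) = (d + y) / v"
  proof -
    have "c + 1 / (d + x) = u / (d + x)" "c + 1 / (d + y) = v / (d + y)"
      using assms by (simp_all add: u_def v_def field_simps)
    then show "1 / (c + 1 / (d + x)) = (d + x) / u" "1 / (c + 1 / (d + y)) = (d + y) / v"
      by simp_all
  qed
  then have "1 / (c + 1 / (d + x)) - 1 / (c + 1 / (d + y)) = (x - y) / (u * v)"
    using uv by (simp add: diff_frac_eq) (simp add: u_def v_def algebra_simps)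
  also have "\<bar>\<dots>\<bar> = \<bar>x - y\<bar> / (u * v)"
    using uv by (simp add: abs_divide abs_mult)
  also have "\<dots> \<le> \<bar>x - y\<bar> / 4"
    using \<open>2 * 2 \<le> u * v\<close> by (intro divide_left_mono) auto
  finally show ?thesis .
qed

lemma cf_trunc_Cauchy_bound:
  assumes "\<forall>k. 1 \<le> a k"
  shows "\<bar>cf_trunc a n - cf_trunc a (n + m)\<bar> \<le> 2 * (1 / 2) ^ n"
  using assms
proof (induction n arbitrary: a rule: induct_nat_012)
  case 0
  then show ?case using cf_trunc_bounds[of a m] by simp
next
  case 1
  have "0 \<le> cf_trunc a (Suc 0) \<and> cf_trunc a (Suc 0) \<le> 1"
       "0 \<le> cf_trunc a (Suc 0 + m) \<and> cf_trunc a (Suc 0 + m) \<le> 1"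
    using cf_trunc_bounds 1 by blast+
  then have "\<bar>cf_trunc a (Suc 0) - cf_trunc a (Suc 0 + m)\<bar> \<le> 1" by linarith
  then show ?case by simp
next
  case (ge2 n)
  let ?b = "digit_shift (digit_shift a)"
  have b: "\<forall>k. 1 \<le> ?b k" and "1 \<le> a 0" "1 \<le> a 1" using ge2.prems by auto
  then have "\<bar>cf_trunc a (Suc (Suc n)) - cf_trunc a (Suc (Suc n) + m)\<bar>
      \<le> \<bar>cf_trunc ?b n - cf_trunc ?b (n + m)\<bar> / 4"
    unfolding add_Suc cf_trunc_Suc_shift
    using \<open>1 \<le> a 0\<close> \<open>1 \<le> a 1\<close>
    by (intro cf_two_step_contraction cf_trunc_bounds[OF b, THEN conjunct1]) simp_all
  also have "\<dots> \<le> 2 * (1 / 2) ^ n / 4"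
    by (intro divide_right_mono ge2.IH(1)[OF b]) simp
  finally show ?case by simp
qed

lemma cf_trunc_tendsto:
  assumes "\<forall>k. 1 \<le> a k"
  shows "cf_trunc a \<longlonglongrightarrow> cf_coding a"
proof -
  have "Cauchy (cf_trunc a)"
  proof (rule metric_CauchyI)
    fix e :: real assume "0 < e"
    then obtain N where N: "(1 / 2) ^ N < e / 4"
      using real_arch_pow_inv[of "e / 4" "1 / 2"] by auto
    have d: "dist (cf_trunc a n) (cf_trunc a N) < e / 2" if "N \<le> n" for n
      using cf_trunc_Cauchy_bound[OF assms, of N "n - N"] that N
      by (simp add: dist_real_def abs_minus_commute)
    show "\<exists>M. \<forall>m\<ge>M. \<forall>n\<ge>M. dist (cf_trunc a m) (cf_trunc a n) < e"
      using d dist_triangle_half_l by blast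
  qed
  then show ?thesis
    unfolding cf_coding_def by (simp add: Cauchy_convergent_iff convergent_LIMSEQ_iff)
qed

lemma cf_coding_unfold:
  assumes a: "\<forall>k. 1 \<le> a k"
  shows "cf_coding a = 1 / (real (a 0) + cf_coding (digit_shift a))"
proof -
  have s: "\<forall>k. 1 \<le> digit_shift a k" using a by simp
  have "0 \<le> cf_coding (digit_shift a)"
    using cf_trunc_bounds[OF s] by (intro LIMSEQ_le_const[OF cf_trunc_tendsto[OF s]]) auto
  moreover have "1 \<le> a 0" using a by auto
  ultimately have "(\<lambda>n. 1 / (real (a 0) + cf_trunc (digit_shift a) n))
      \<longlonglongrightarrow> 1 / (real (a 0) + cf_coding (digit_shift a))"
    by (intro tendsto_intros cf_trunc_tendsto[OF s]) auto
  then have "(\<lambda>n. cf_trunc a (Suc n)) \<longlonglongrightarrow> 1 / (real (a 0) + cf_coding (digit_shift a))"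
    by (simp only: cf_trunc_Suc_shift)
  then have "cf_trunc a \<longlonglongrightarrow> 1 / (real (a 0) + cf_coding (digit_shift a))"
    by (simp only: filterlim_sequentially_Suc)
  then show ?thesis
    using LIMSEQ_unique cf_trunc_tendsto[OF a] by blast
qed

lemma cf_coding_bounds:
  assumes a: "\<forall>k. 1 \<le> a k"
  shows "0 < cf_coding a" "cf_coding a < 1"
proof -
  have pos: "0 < cf_coding b" if b: "\<forall>k. 1 \<le> b k" for b :: "nat \<Rightarrow> nat"
  proof -
    have s: "\<forall>k. 1 \<le> digit_shift b k" using b by simp
    have "0 \<le> cf_coding (digit_shift b)"
      using cf_trunc_bounds[OF s] by (intro LIMSEQ_le_const[OF cf_trunc_tendsto[OF s]]) auto
    moreover have "1 \<le> b 0" using b by auto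
    ultimately show ?thesis using cf_coding_unfold[OF b] by simp
  qed
  show "0 < cf_coding a" using pos[OF a] .
  have "0 < cf_coding (digit_shift a)" by (rule pos) (use a in auto)
  moreover have "1 \<le> real (a 0)" using a by simp
  ultimately have "1 < real (a 0) + cf_coding (digit_shift a)" by linarith
  then show "cf_coding a < 1" using cf_coding_unfold[OF a] by simp
qed

text \<open>
  If \<open>p\<^sub>k / q\<^sub>k\<close> are the convergents of \<open>x = cf_coding a\<close>, this product is
  \<open>\<bar>q\<^sub>n\<^sub>-\<^sub>1 x - p\<^sub>n\<^sub>-\<^sub>1\<bar>\<close>, which lies between \<open>1 / (2 q\<^sub>n)\<close> and \<open>1 / q\<^sub>n\<close>. Its square is
  therefore comparable to the length of the interval of numbers sharing the first \<open>n\<close> digits of \<open>x\<close>.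
  In contrast to \<open>q\<^sub>n\<close> it is exactly multiplicative along the orbit of the shift.
\<close>
definition cf_prod :: "(nat \<Rightarrow> nat) \<Rightarrow> nat \<Rightarrow> real" where
  "cf_prod a n = (\<Prod>k<n. cf_coding ((digit_shift ^^ k) a))"

lemma cf_prod_pos: "\<forall>k. 1 \<le> a k \<Longrightarrow> 0 < cf_prod a n"
  unfolding cf_prod_def by (intro prod_pos) (simp add: cf_coding_bounds)

text \<open>
  Two consecutive factors have the product \<open>y / (a (2 * n) + y) \<le> 1 / 2\<close>, because
  \<open>y < 1 \<le> a (2 * n)\<close>.
\<close>
lemma cf_prod_halves:
  assumes a: "\<forall>k. 1 \<le> a k"
  shows "cf_prod a (2 * n) \<le> (1 / 2) ^ n"
proof (induction n)
  case (Suc n)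
  define x where "x = cf_coding ((digit_shift ^^ (2 * n)) a)"
  define y where "y = cf_coding ((digit_shift ^^ Suc (2 * n)) a)"
  have "x = 1 / (real (a (2 * n)) + y)"
    using cf_coding_unfold[of "(digit_shift ^^ (2 * n)) a"] a by (simp add: x_def y_def)
  moreover have y: "0 < y" "y < 1" unfolding y_def
    by (rule cf_coding_bounds; use a in \<open>simp del: funpow.simps\<close>)+
  moreover have "1 \<le> real (a (2 * n))" using a by simp
  ultimately have "x * y = y / (real (a (2 * n)) + y)" "2 * y \<le> real (a (2 * n)) + y"
    "0 < real (a (2 * n)) + y" by auto
  then have xy: "x * y \<le> 1 / 2" by (simp only: divide_le_eq) simp
  have "cf_prod a (2 * Suc n) = cf_prod a (2 * n) * (x * y)"
    by (simp add: cf_prod_def x_def y_def)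
  also have "\<dots> \<le> (1 / 2) ^ n * (1 / 2)"
  proof (intro mult_mono' Suc xy)
    have "0 < x" unfolding x_def by (rule cf_coding_bounds) (use a in simp)
    then show "0 \<le> x * y" using y by simp
    show "0 \<le> cf_prod a (2 * n)" using cf_prod_pos[OF a] less_imp_le by blast
  qed
  finally show ?case by simp
qed (simp add: cf_prod_def)

text \<open>
  The identity \<open>1 / (c + x) - 1 / (c + y) = (y - x) * (1 / (c + x)) * (1 / (c + y))\<close> for a common
  digit \<open>c\<close> is iterated over the common prefix. Since it is an identity, the two metric estimates below
  need no distortion constants.
\<close>
lemma cf_coding_diff:
  assumes a: "\<forall>k. 1 \<le> a k" and b: "\<forall>k. 1 \<le> b k" and eq: "\<forall>k<n. a k = b k"
  shows "\<bar>cf_coding a - cf_coding b\<bar> =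
    cf_prod a n * cf_prod b n * \<bar>cf_coding ((digit_shift ^^ n) a) - cf_coding ((digit_shift ^^ n) b)\<bar>"
  using eq
proof (induction n)
  case (Suc n)
  define x y where "x = cf_coding ((digit_shift ^^ Suc n) a)" and "y = cf_coding ((digit_shift ^^ Suc n) b)"
  have pos: "0 < x" "0 < y" unfolding x_def y_def
    by (rule cf_coding_bounds; use a b in \<open>simp del: funpow.simps\<close>)+
  have 1: "1 \<le> real (a n)" "a n = b n" using a b Suc.prems by auto
  have un: "cf_coding ((digit_shift ^^ n) a) = 1 / (real (a n) + x)"
           "cf_coding ((digit_shift ^^ n) b) = 1 / (real (a n) + y)"
    using cf_coding_unfold[of "(digit_shift ^^ n) a"] cf_coding_unfold[of "(digit_shift ^^ n) b"] a b 1
    by (simp_all add: x_def y_def)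
  have "1 / (real (a n) + x) - 1 / (real (a n) + y)
      = (1 / (real (a n) + x)) * (1 / (real (a n) + y)) * (y - x)"
    using pos 1 by (simp add: divide_simps)
  then have "\<bar>cf_coding ((digit_shift ^^ n) a) - cf_coding ((digit_shift ^^ n) b)\<bar>
      = cf_coding ((digit_shift ^^ n) a) * cf_coding ((digit_shift ^^ n) b) * \<bar>x - y\<bar>"
    unfolding un using pos 1 by (simp add: abs_mult abs_minus_commute)
  note step = this
  have Sucs: "cf_prod c (Suc n) = cf_prod c n * cf_coding ((digit_shift ^^ n) c)" for c
    by (simp add: cf_prod_def)
  have "\<bar>cf_coding a - cf_coding b\<bar>
      = cf_prod a n * cf_prod b n * \<bar>cf_coding ((digit_shift ^^ n) a) - cf_coding ((digit_shift ^^ n) b)\<bar>"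
    by (rule Suc.IH) (use Suc.prems in simp)
  also have "\<dots> = cf_prod a (Suc n) * cf_prod b (Suc n) * \<bar>x - y\<bar>"
    unfolding step Sucs by (simp add: mult_ac)
  finally show ?case by (simp only: x_def y_def)
qed (simp add: cf_prod_def)

lemma cf_coding_diff_upper:
  assumes a: "\<forall>k. 1 \<le> a k" and b: "\<forall>k. 1 \<le> b k" and eq: "\<forall>k<n. a k = b k"
  shows "\<bar>cf_coding a - cf_coding b\<bar> \<le> cf_prod a n * cf_prod b n"
proof -
  have "\<bar>cf_coding ((digit_shift ^^ n) a) - cf_coding ((digit_shift ^^ n) b)\<bar> \<le> 1"
    using cf_coding_bounds[of "(digit_shift ^^ n) a"] cf_coding_bounds[of "(digit_shift ^^ n) b"] a b
    by (simp add: abs_le_iff)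
  then show ?thesis
    unfolding cf_coding_diff[OF assms]
    using cf_prod_pos[OF a, of n] cf_prod_pos[OF b, of n] by (simp add: mult_left_le)
qed

text \<open>
  After the common prefix the two numbers are \<open>1 / (c + x)\<close> and \<open>1 / (d + y)\<close> with different
  integers \<open>c\<close>, \<open>d\<close>. They can be close only if \<open>c + x\<close> and \<open>d + y\<close> are, and for \<open>c < d\<close> these differ
  by at least \<open>1 - x + y \<ge> y \<ge> x * y\<close>. The resulting factors \<open>x\<close> and \<open>y\<close> are the reason why
  the products run up to \<open>n + 2\<close>.
\<close>
lemma cf_coding_diff_lower:
  assumes a: "\<forall>k. 1 \<le> a k" and b: "\<forall>k. 1 \<le> b k" and eq: "\<forall>k<n. a k = b k"
    and ne: "a n \<noteq> b n"
  shows "cf_prod a (n + 2) * cf_prod b (n + 2) \<le> \<bar>cf_coding a - cf_coding b\<bar>"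
proof -
  define x0 x1 where "x0 = cf_coding ((digit_shift ^^ n) a)" and "x1 = cf_coding ((digit_shift ^^ Suc n) a)"
  define y0 y1 where "y0 = cf_coding ((digit_shift ^^ n) b)" and "y1 = cf_coding ((digit_shift ^^ Suc n) b)"
  have bnd: "0 < x0" "0 < x1" "x1 < 1" "0 < y0" "0 < y1" "y1 < 1"
    unfolding x0_def x1_def y0_def y1_def
    by (rule cf_coding_bounds; use a b in \<open>simp del: funpow.simps\<close>)+
  have 1: "1 \<le> real (a n)" "1 \<le> real (b n)" using a b by auto
  have un: "x0 = 1 / (real (a n) + x1)" "y0 = 1 / (real (b n) + y1)"
    using cf_coding_unfold[of "(digit_shift ^^ n) a"] cf_coding_unfold[of "(digit_shift ^^ n) b"] a b
    by (simp_all add: x0_def x1_def y0_def y1_def)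
  have "x0 - y0 = x0 * y0 * ((real (b n) + y1) - (real (a n) + x1))"
    unfolding un using bnd 1 by (simp add: divide_simps)
  then have d: "\<bar>x0 - y0\<bar> = x0 * y0 * \<bar>(real (b n) + y1) - (real (a n) + x1)\<bar>"
    using bnd by (simp add: abs_mult)
  have "x1 * y1 \<le> x1" "x1 * y1 \<le> y1" using bnd by (auto simp: mult_le_cancel_left1 mult_le_cancel_right1)
  moreover have "real (a n) + 1 \<le> real (b n) \<or> real (b n) + 1 \<le> real (a n)" using ne by linarith
  ultimately have "x1 * y1 \<le> \<bar>(real (b n) + y1) - (real (a n) + x1)\<bar>" using bnd by linarith
  then have "x0 * y0 * (x1 * y1) \<le> \<bar>x0 - y0\<bar>"
    unfolding d using bnd by (intro mult_left_mono) auto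
  then have "cf_prod a n * cf_prod b n * (x0 * y0 * (x1 * y1)) \<le> cf_prod a n * cf_prod b n * \<bar>x0 - y0\<bar>"
    using cf_prod_pos[OF a, of n] cf_prod_pos[OF b, of n] by (intro mult_left_mono) auto
  also have "\<dots> = \<bar>cf_coding a - cf_coding b\<bar>"
    unfolding cf_coding_diff[OF a b eq] x0_def y0_def ..
  finally show ?thesis
    by (simp add: cf_prod_def x0_def x1_def y0_def y1_def mult_ac)
qed

text \<open>
  Half of \<open>ln \<bar>T' x\<bar>\<close> at \<open>x = cf_coding a\<close>, where \<open>T x = 1 / x - \<lfloor>1 / x\<rfloor>\<close> is the Gauss map,
  to which the coding carries the shift.
\<close>
definition cf_log :: "(nat \<Rightarrow> nat) \<Rightarrow> real" where
  "cf_log a = - ln (cf_coding a)"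

lemma cf_log_unfold:
  assumes a: "\<forall>k. 1 \<le> a k"
  shows "cf_log a = ln (real (a 0) + cf_coding (digit_shift a))"
proof -
  have "0 < real (a 0) + cf_coding (digit_shift a)"
    using cf_coding_bounds(1)[of "digit_shift a"] a by (simp add: add_nonneg_pos)
  then show ?thesis
    unfolding cf_log_def cf_coding_unfold[OF a] by (simp add: ln_div)
qed

lemma cf_log_pos: "\<forall>k. 1 \<le> a k \<Longrightarrow> 0 < cf_log a"
  using cf_coding_bounds[of a] by (simp add: cf_log_def)

lemma cf_log_bounds:
  assumes a: "\<forall>k. 1 \<le> a k"
  shows "ln (real (a 0)) \<le> cf_log a" "cf_log a \<le> ln (real (a 0) + 1)"
proof -
  have "1 \<le> real (a 0)" using a by simp
  moreover have "0 < a 0" using a by (simp add: Suc_le_eq)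
  ultimately show "ln (real (a 0)) \<le> cf_log a" "cf_log a \<le> ln (real (a 0) + 1)"
    unfolding cf_log_unfold[OF a] using cf_coding_bounds[of "digit_shift a"] a
    by (auto intro!: ln_mono)
qed

lemma cf_prod_eq_exp:
  assumes "\<forall>k. 1 \<le> a k"
  shows "cf_prod a n = exp (- (\<Sum>k<n. cf_log ((digit_shift ^^ k) a)))"
proof -
  have "cf_coding ((digit_shift ^^ k) a) = exp (- cf_log ((digit_shift ^^ k) a))" for k
    using cf_coding_bounds(1)[of "(digit_shift ^^ k) a"] assms by (simp add: cf_log_def)
  then show ?thesis
    unfolding cf_prod_def by (simp add: exp_sum sum_negf[symmetric])
qed

section \<open>A maximal ergodic lemma\<close>

definition birkhoff :: "('a \<Rightarrow> 'a) \<Rightarrow> ('a \<Rightarrow> real) \<Rightarrow> nat \<Rightarrow> 'a \<Rightarrow> real" where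
  "birkhoff T f n a = (\<Sum>k<n. f ((T ^^ k) a))"

lemma birkhoff_0 [simp]: "birkhoff T f 0 a = 0"
  by (simp add: birkhoff_def)

lemma birkhoff_Suc: "birkhoff T f (Suc n) a = f a + birkhoff T f n (T a)"
  by (simp add: birkhoff_def sum.lessThan_Suc_shift funpow_swap1 del: sum.lessThan_Suc)

lemma measurable_birkhoff [measurable]:
  assumes [measurable]: "T \<in> measurable M M" "f \<in> borel_measurable M"
  shows "birkhoff T f n \<in> borel_measurable M"
proof (induction n)
  case 0
  then show ?case by (simp add: birkhoff_def[abs_def])
next
  case (Suc n)
  note Suc [measurable]
  have "birkhoff T f (Suc n) = (\<lambda>a. f a + birkhoff T f n (T a))"
    by (simp add: birkhoff_Suc fun_eq_iff)
  then show ?case by simp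
qed

text \<open>
  The maximum of the Birkhoff sums of orders \<open>0, \<dots>, n\<close>; in this recursive form the identity behind
  the maximal ergodic lemma is the definition.
\<close>
primrec max_birkhoff :: "('a \<Rightarrow> 'a) \<Rightarrow> ('a \<Rightarrow> real) \<Rightarrow> nat \<Rightarrow> 'a \<Rightarrow> real" where
  "max_birkhoff T f 0 a = 0"
| "max_birkhoff T f (Suc n) a = max 0 (f a + max_birkhoff T f n (T a))"

lemma max_birkhoff_nonneg: "0 \<le> max_birkhoff T f n a"
  by (cases n) auto

lemma max_birkhoff_mono: "max_birkhoff T f n a \<le> max_birkhoff T f (Suc n) a"
proof (induction n arbitrary: a)
  case (Suc n)
  show ?case using Suc[of "T a"] by (auto simp: max_def)
qed simp

lemma birkhoff_le_max_birkhoff: "birkhoff T f n a \<le> max_birkhoff T f n a"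
proof (induction n arbitrary: a)
  case (Suc n)
  show ?case using Suc[of "T a"] by (simp add: birkhoff_Suc)
qed simp

lemma integral_invariant:
  fixes f :: "'a \<Rightarrow> real"
  assumes "T \<in> measurable M M" "distr M M T = M" "f \<in> borel_measurable M"
  shows "(\<integral>a. f (T a) \<partial>M) = (\<integral>a. f a \<partial>M)"
  using integral_distr[OF assms(1,3)] unfolding assms(2) ..

lemma integrable_invariant:
  fixes f :: "'a \<Rightarrow> real"
  assumes "T \<in> measurable M M" "distr M M T = M" "integrable M f"
  shows "integrable M (\<lambda>a. f (T a))"
  by (rule integrable_distr[OF assms(1)]) (simp only: assms)

text \<open>
  Garsia's argument. Let \<open>R\<^sub>n\<close> be the maximum of the first Birkhoff sums. Where \<open>R\<^sub>n\<^sub>+\<^sub>1 > 0\<close> one has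
  \<open>f = R\<^sub>n\<^sub>+\<^sub>1 - R\<^sub>n \<circ> T\<close>, and elsewhere \<open>R\<^sub>n\<^sub>+\<^sub>1 - R\<^sub>n \<circ> T \<le> 0\<close>; so by invariance of the measure the
  integral of \<open>f\<close> over \<open>{R\<^sub>n\<^sub>+\<^sub>1 > 0}\<close> is at least \<open>\<integral>R\<^sub>n\<^sub>+\<^sub>1 - \<integral>R\<^sub>n \<ge> 0\<close>. If these sets exhausted the
  space, the integral of \<open>f\<close> would be nonnegative.
\<close>
lemma maximal_ergodic_lemma:
  assumes T [measurable]: "T \<in> measurable M M" and inv: "distr M M T = M"
    and f: "integrable M f" and neg: "(\<integral>a. f a \<partial>M) < 0"
  shows "\<not> (AE a in M. \<exists>n. 0 < birkhoff T f n a)"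
proof
  assume AE: "AE a in M. \<exists>n. 0 < birkhoff T f n a"
  let ?R = "max_birkhoff T f"
  have [measurable]: "f \<in> borel_measurable M" using f by auto
  have R_Suc: "?R (Suc n) = (\<lambda>a. max 0 (f a + ?R n (T a)))" for n
    by (simp add: fun_eq_iff)
  have R: "integrable M (?R n)" for n
  proof (induction n)
    case 0
    then show ?case by simp
  next
    case (Suc n)
    then have "integrable M (\<lambda>a. ?R n (T a))"
      by (rule integrable_invariant[OF T inv])
    then show ?case unfolding R_Suc by (intro integrable_max) (use f in auto)
  qed
  have [measurable]: "?R n \<in> borel_measurable M" for n using R by auto
  define g where "g n a = indicator {a \<in> space M. 0 < ?R (Suc n) a} a * f a" for n a
  have g [measurable]: "g n \<in> borel_measurable M" for n
    unfolding g_def by measurable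
  have g_int: "integrable M (g n)" for n
    by (rule Bochner_Integration.integrable_bound[OF f]) (auto simp: g_def indicator_def)
  have "0 \<le> (\<integral>a. g n a \<partial>M)" for n
  proof -
    have "0 \<le> (\<integral>a. ?R (Suc n) a \<partial>M) - (\<integral>a. ?R n a \<partial>M)"
      using integral_mono[OF R R max_birkhoff_mono] by simp
    also have "\<dots> = (\<integral>a. ?R (Suc n) a \<partial>M) - (\<integral>a. ?R n (T a) \<partial>M)"
      using integral_invariant[OF T inv, of "?R n"] by simp
    also have "\<dots> = (\<integral>a. ?R (Suc n) a - ?R n (T a) \<partial>M)"
      using R integrable_invariant[OF T inv R] by (intro Bochner_Integration.integral_diff[symmetric])
    also have "\<dots> \<le> (\<integral>a. g n a \<partial>M)"
    proof (intro integral_mono g_int Bochner_Integration.integrable_diff R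
        integrable_invariant[OF T inv R])
      fix a assume "a \<in> space M"
      then show "?R (Suc n) a - ?R n (T a) \<le> g n a"
        using max_birkhoff_nonneg[of T f n "T a"] by (auto simp: g_def indicator_def max_def)
    qed
    finally show ?thesis .
  qed
  moreover have "(\<lambda>n. \<integral>a. g n a \<partial>M) \<longlonglongrightarrow> (\<integral>a. f a \<partial>M)"
  proof (rule integral_dominated_convergence[where w = "\<lambda>a. \<bar>f a\<bar>"])
    have "(\<lambda>m. g m a) \<longlonglongrightarrow> f a" if a: "a \<in> space M" and n: "0 < birkhoff T f n a" for a n
    proof -
      have "g m a = f a" if m: "n \<le> m" for m
      proof -
        have "?R n a \<le> ?R (Suc m) a"
          by (rule lift_Suc_mono_le[where f = "\<lambda>n. ?R n a", OF max_birkhoff_mono]) (use m in linarith)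
        then have "0 < ?R (Suc m) a"
          using n birkhoff_le_max_birkhoff[of T f n a] by linarith
        then show ?thesis using a by (simp add: g_def del: max_birkhoff.simps)
      qed
      then have "eventually (\<lambda>m. g m a = f a) sequentially"
        unfolding eventually_sequentially by blast
      then show ?thesis by (rule tendsto_eventually)
    qed
    then show "AE a in M. (\<lambda>n. g n a) \<longlonglongrightarrow> f a"
      by - (rule AE_mp[OF AE], rule AE_I2, blast)
    show "AE x in M. norm (g n x) \<le> \<bar>f x\<bar>" for n
      by (intro AE_I2) (simp add: g_def indicator_def)
    show "integrable M (\<lambda>a. \<bar>f a\<bar>)" using f by (rule integrable_abs)
  qed measurable
  ultimately have "0 \<le> (\<integral>a. f a \<partial>M)"
    using LIMSEQ_le_const by blast
  then show False using neg by simp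
qed

section \<open>Bernoulli measures on digit sequences\<close>

lemma measurable_digit [measurable]:
  "(\<lambda>a. a k) \<in> measurable (bernoulli_measure p) (count_space UNIV)"
proof -
  have "(\<lambda>a. a k) \<in> measurable (bernoulli_measure p) (digit_measure p)"
    unfolding bernoulli_measure_def by (rule measurable_component_singleton) simp
  moreover have "(\<lambda>i. i) \<in> measurable (digit_measure p) (count_space UNIV)"
    by (simp add: digit_measure_def)
  ultimately show ?thesis by (rule measurable_compose)
qed

lemma measurable_digit_shift [measurable]:
  "digit_shift \<in> measurable (bernoulli_measure p) (bernoulli_measure p)"
  unfolding bernoulli_measure_def digit_shift_def[abs_def]
  by (rule measurable_PiM_single') (auto simp: space_PiM)

lemma measurable_digit_shift_funpow [measurable]:
  "(digit_shift ^^ n) \<in> measurable (bernoulli_measure p) (bernoulli_measure p)"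
proof (induction n)
  case (Suc n)
  then show ?case by (simp only: funpow.simps) (rule measurable_comp[OF _ measurable_digit_shift])
qed simp

declare measurable_cf_coding [measurable]

lemma measurable_cf_log [measurable]: "cf_log \<in> borel_measurable (bernoulli_measure p)"
  unfolding cf_log_def[abs_def] by measurable

lemma nn_integral_digit_measure:
  "(\<integral>\<^sup>+i. f i \<partial>digit_measure p) = (\<Sum>i. ennreal (p (Suc i)) * f (Suc i))"
proof -
  have bij: "bij_betw Suc UNIV {1..}"
    by (rule bij_betwI[of _ _ _ "\<lambda>n. n - 1"]) auto
  have "(\<integral>\<^sup>+i. f i \<partial>digit_measure p) = (\<integral>\<^sup>+i. ennreal (p i) * f i \<partial>count_space {1..})"
    by (simp add: digit_measure_def point_measure_def nn_integral_density)
  also have "\<dots> = (\<integral>\<^sup>+i. ennreal (p (Suc i)) * f (Suc i) \<partial>count_space UNIV)"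
    using nn_integral_bij_count_space[OF bij, of "\<lambda>i. ennreal (p i) * f i"] by simp
  finally show ?thesis by (simp add: nn_integral_count_space_nat)
qed

text \<open>
  Conditioning on the first digit, which is independent of the later ones. The invariance of the measure
  under the shift, the law of a digit and the semicontinuity proved later by induction on the number
  of digits are all consequences.
\<close>
lemma nn_integral_bernoulli_first_digit:
  assumes p: "p \<in> prob_vectors" and f [measurable]: "f \<in> borel_measurable (bernoulli_measure p)"
  shows "(\<integral>\<^sup>+a. f a \<partial>bernoulli_measure p)
    = (\<Sum>i. ennreal (p (Suc i)) * (\<integral>\<^sup>+a. f (case_nat (Suc i) a) \<partial>bernoulli_measure p))"
proof -
  interpret D: prob_space "digit_measure p" by (rule prob_space_digit_measure[OF p])
  interpret sequence_space "digit_measure p" by unfold_locales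
  interpret B: prob_space "bernoulli_measure p" by (rule prob_space_bernoulli_measure[OF p])
  let ?f = "\<lambda>(s, \<omega>). case_nat s \<omega>"
  have [measurable]: "?f \<in> measurable (digit_measure p \<Otimes>\<^sub>M bernoulli_measure p) (bernoulli_measure p)"
    unfolding bernoulli_measure_def by measurable
  have "(\<integral>\<^sup>+a. f a \<partial>bernoulli_measure p)
      = (\<integral>\<^sup>+a. f a \<partial>distr (digit_measure p \<Otimes>\<^sub>M bernoulli_measure p) (bernoulli_measure p) ?f)"
    using PiM_iter by (simp add: bernoulli_measure_def)
  also have "\<dots> = (\<integral>\<^sup>+z. f (?f z) \<partial>(digit_measure p \<Otimes>\<^sub>M bernoulli_measure p))"
    by (rule nn_integral_distr) measurable
  also have "\<dots> = (\<integral>\<^sup>+i. \<integral>\<^sup>+a. f (?f (i, a)) \<partial>bernoulli_measure p \<partial>digit_measure p)"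
    by (rule B.nn_integral_fst[symmetric]) measurable
  finally show ?thesis by (simp add: nn_integral_digit_measure)
qed

lemma suminf_prob_vector:
  assumes "p \<in> prob_vectors" shows "(\<Sum>i. ennreal (p (Suc i))) = 1"
proof -
  have "(\<lambda>i. p (Suc i)) sums 1" "\<And>i. 0 \<le> p (Suc i)"
    using assms by (auto simp: prob_vectors_def)
  from suminf_ennreal_eq[OF this(2,1)] show ?thesis by simp
qed

lemma nn_integral_bernoulli_digit:
  assumes p: "p \<in> prob_vectors"
  shows "(\<integral>\<^sup>+a. f (a 0) \<partial>bernoulli_measure p) = (\<Sum>i. ennreal (p (Suc i)) * f (Suc i))"
proof -
  interpret B: prob_space "bernoulli_measure p" by (rule prob_space_bernoulli_measure[OF p])
  show ?thesis
    using nn_integral_bernoulli_first_digit[OF p, of "\<lambda>a. f (a 0)"] by (simp add: B.emeasure_space_1)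
qed

lemma distr_shift_bernoulli:
  assumes p: "p \<in> prob_vectors"
  shows "distr (bernoulli_measure p) (bernoulli_measure p) digit_shift = bernoulli_measure p"
proof (rule measure_eqI)
  fix A assume "A \<in> sets (distr (bernoulli_measure p) (bernoulli_measure p) digit_shift)"
  then have A [measurable]: "A \<in> sets (bernoulli_measure p)" by simp
  let ?M = "bernoulli_measure p"
  have "emeasure (distr ?M ?M digit_shift) A = (\<integral>\<^sup>+a. indicator A a \<partial>distr ?M ?M digit_shift)"
    by simp
  also have "\<dots> = (\<integral>\<^sup>+a. indicator A (digit_shift a) \<partial>?M)"
    by (rule nn_integral_distr) measurable
  also have "\<dots> = (\<Sum>i. ennreal (p (Suc i)) * emeasure ?M A)"
    using nn_integral_bernoulli_first_digit[OF p, of "\<lambda>a. indicator A (digit_shift a)"] by simp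
  also have "\<dots> = emeasure ?M A"
    by (simp add: suminf_prob_vector[OF p])
  finally show "emeasure (distr ?M ?M digit_shift) A = emeasure ?M A" .
qed simp

lemma distr_digit_shift_funpow_bernoulli:
  assumes p: "p \<in> prob_vectors"
  shows "distr (bernoulli_measure p) (bernoulli_measure p) (digit_shift ^^ n) = bernoulli_measure p"
proof (induction n)
  case (Suc n)
  let ?M = "bernoulli_measure p"
  have "distr ?M ?M (digit_shift ^^ Suc n) = distr (distr ?M ?M (digit_shift ^^ n)) ?M digit_shift"
    by (simp add: distr_distr del: digit_shift_apply)
  then show ?case by (simp only: Suc distr_shift_bernoulli[OF p])
qed (simp add: distr_id2 id_def)

lemma AE_digit_pos:
  assumes p: "p \<in> prob_vectors"
  shows "AE a in bernoulli_measure p. \<forall>k. 0 < p (a k)"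
proof -
  let ?M = "bernoulli_measure p"
  have "(\<integral>\<^sup>+a. indicator {i. \<not> 0 < p i} (a 0) \<partial>?M) = 0"
    unfolding nn_integral_bernoulli_digit[OF p]
  proof -
    have "ennreal (p (Suc i)) * indicator {i. \<not> 0 < p i} (Suc i) = 0" for i
      using p by (auto simp: indicator_def ennreal_neg)
    then show "(\<Sum>i. ennreal (p (Suc i)) * indicator {i. \<not> 0 < p i} (Suc i)) = 0"
      by (simp only: suminf_zero)
  qed
  then have 0: "AE a in ?M. 0 < p (a 0)"
    by (subst (asm) nn_integral_0_iff_AE) (auto simp: indicator_def split: if_splits)
  have "AE a in ?M. 0 < p (a k)" for k
  proof -
    have "AE a in distr ?M ?M (digit_shift ^^ k). 0 < p (a 0)"
      unfolding distr_digit_shift_funpow_bernoulli[OF p] by (rule 0)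
    from AE_distrD[OF measurable_digit_shift_funpow this] show ?thesis by simp
  qed
  then show ?thesis by (simp add: AE_all_countable)
qed

lemma emeasure_bernoulli_cylinder:
  assumes p: "p \<in> prob_vectors" and w: "\<forall>k. 1 \<le> w k"
  shows "emeasure (bernoulli_measure p) {a \<in> space (bernoulli_measure p). \<forall>k<n. a k = w k}
    = ennreal (\<Prod>k<n. p (w k))"
proof -
  interpret D: prob_space "digit_measure p" by (rule prob_space_digit_measure[OF p])
  interpret product_prob_space "\<lambda>_. digit_measure p" "UNIV :: nat set" by unfold_locales
  have "emeasure (\<Pi>\<^sub>M n\<in>UNIV. digit_measure p)
      {a \<in> space (\<Pi>\<^sub>M n\<in>UNIV. digit_measure p). \<forall>k\<in>{..<n}. a k \<in> {w k}}
      = (\<Prod>k<n. emeasure (digit_measure p) {w k})"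
    using w by (intro emeasure_PiM_Collect) (auto simp: digit_measure_def sets_point_measure)
  also have "\<dots> = (\<Prod>k<n. ennreal (p (w k)))"
    using w by (simp add: emeasure_digit_measure)
  also have "\<dots> = ennreal (\<Prod>k<n. p (w k))"
    using p w by (intro prod_ennreal) (simp add: prob_vectors_def)
  finally show ?thesis
    by (simp add: bernoulli_measure_def Ball_def)
qed

text \<open>
  An invariant event is its own preimage under every power of the shift. It is thus determined by the
  digits from any given position on, and Kolmogorov's law applies.
\<close>
lemma shift_invariant_0_1:
  assumes p: "p \<in> prob_vectors" and G: "G \<in> sets (bernoulli_measure p)"
    and inv: "\<And>a. a \<in> space (bernoulli_measure p) \<Longrightarrow> digit_shift a \<in> G \<longleftrightarrow> a \<in> G"
  shows "measure (bernoulli_measure p) G = 0 \<or> measure (bernoulli_measure p) G = 1"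
proof -
  let ?M = "bernoulli_measure p"
  interpret D: prob_space "digit_measure p" by (rule prob_space_digit_measure[OF p])
  interpret product_prob_space "\<lambda>_. digit_measure p" "UNIV :: nat set" by unfold_locales
  interpret B: prob_space ?M by (rule prob_space_bernoulli_measure[OF p])
  define F where "F k = {(\<lambda>a. a k) -` A \<inter> space ?M | A. A \<in> sets (digit_measure p)}" for k :: nat
  have comp: "(\<lambda>a. a k) \<in> measurable ?M (digit_measure p)" for k :: nat
    unfolding bernoulli_measure_def by (rule measurable_component_singleton) simp
  have "B.indep_vars (\<lambda>_. digit_measure p) (\<lambda>k a. a k) (UNIV :: nat set)"
  proof (subst B.indep_vars_iff_distr_eq_PiM)
    show "distr ?M (\<Pi>\<^sub>M k\<in>UNIV. digit_measure p) (\<lambda>a. \<lambda>k\<in>UNIV. a k)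
        = (\<Pi>\<^sub>M k\<in>UNIV. distr ?M (digit_measure p) (\<lambda>a. a k))"
    proof -
      have "distr ?M (digit_measure p) (\<lambda>a. a k) = digit_measure p" for k
        unfolding bernoulli_measure_def
        by (rule distr_PiM_component) (auto simp: D.prob_space_axioms)
      then show ?thesis by (simp add: distr_id2 bernoulli_measure_def restrict_UNIV)
    qed
  qed (use comp in auto)
  then have "B.indep_sets F UNIV"
    unfolding B.indep_vars_def2 F_def by simp
  moreover have F_alg: "sigma_algebra (space ?M) (F k)" for k
  proof -
    have "F k = sets (vimage_algebra (space ?M) (\<lambda>a. a k) (digit_measure p))"
      using measurable_space[OF comp] by (auto simp: F_def sets_vimage_algebra2)
    then show ?thesis
      using sets.sigma_algebra_axioms[of "vimage_algebra (space ?M) (\<lambda>a. a k) (digit_measure p)"]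
      by simp
  qed
  moreover have "G \<in> B.tail_events F"
    unfolding B.tail_events_def
  proof (intro INT_I)
    fix n
    let ?N = "sigma (space ?M) (\<Union> (F ` {n..}))"
    have sub: "\<Union> (F ` {n..}) \<subseteq> Pow (space ?M)" by (auto simp: F_def)
    have sp: "space ?N = space ?M" by (rule space_measure_of[OF sub])
    have "(digit_shift ^^ n) \<in> measurable ?N (\<Pi>\<^sub>M k\<in>UNIV. digit_measure p)"
    proof (rule measurable_PiM_single')
      fix k :: nat
      show "(\<lambda>a. (digit_shift ^^ n) a k) \<in> measurable ?N (digit_measure p)"
      proof (rule measurableI)
        fix a assume "a \<in> space ?N"
        then show "(digit_shift ^^ n) a k \<in> space (digit_measure p)"
          unfolding sp by (simp add: space_bernoulli_measure digit_measure_def space_point_measure)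
      next
        fix A assume "A \<in> sets (digit_measure p)"
        then have "(\<lambda>a. (digit_shift ^^ n) a k) -` A \<inter> space ?N \<in> F (n + k)" "n + k \<in> {n..}"
          unfolding sp F_def by auto
        then show "(\<lambda>a. (digit_shift ^^ n) a k) -` A \<inter> space ?N \<in> sets ?N"
          unfolding sets_measure_of[OF sub] by (intro sigma_sets.Basic) blast
      qed
    next
      show "(\<lambda>a k. (digit_shift ^^ n) a k) \<in> space ?N \<rightarrow> (\<Pi>\<^sub>E i\<in>UNIV. space (digit_measure p))"
        unfolding sp by (auto simp: space_bernoulli_measure digit_measure_def space_point_measure)
    qed
    then have "(digit_shift ^^ n) \<in> measurable ?N ?M" by (simp only: bernoulli_measure_def)
    then have "(digit_shift ^^ n) -` G \<inter> space ?N \<in> sets ?N"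
      using G by (rule measurable_sets)
    moreover have "(digit_shift ^^ n) a \<in> G \<longleftrightarrow> a \<in> G" if "a \<in> space ?M" for a
    proof (induction n)
      case (Suc n)
      have "(digit_shift ^^ n) a \<in> space ?M" using that by (simp add: space_bernoulli_measure)
      then show ?case using inv Suc by (simp del: digit_shift_apply digit_shift_funpow)
    qed simp
    then have "(digit_shift ^^ n) -` G \<inter> space ?N = G"
      unfolding sp using sets.sets_into_space[OF G] by auto
    ultimately show "G \<in> sigma_sets (space ?M) (\<Union> (F ` {n..}))"
      by (simp add: sets_measure_of[OF sub])
  qed
  ultimately show ?thesis by (intro B.kolmogorov_0_1_law) 
qed

section \<open>Dimension bounded from above\<close>

text \<open>
  Boundedness above of the Birkhoff sums is a shift invariant property, so it has probability \<open>0\<close> or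
  \<open>1\<close>, and the maximal ergodic lemma excludes \<open>0\<close>. This one-sided statement takes the place of the
  pointwise ergodic theorem in both dimension estimates.
\<close>
lemma birkhoff_shift_bounded_above:
  assumes p: "p \<in> prob_vectors" and f: "integrable (bernoulli_measure p) f"
    and neg: "(\<integral>a. f a \<partial>bernoulli_measure p) < 0"
  shows "AE a in bernoulli_measure p. \<exists>C. \<forall>n. birkhoff digit_shift f n a \<le> C"
proof -
  let ?M = "bernoulli_measure p"
  interpret B: prob_space ?M by (rule prob_space_bernoulli_measure[OF p])
  have [measurable]: "f \<in> borel_measurable ?M" using f by auto
  define G where "G = {a \<in> space ?M. \<exists>C::nat. \<forall>n. birkhoff digit_shift f n a \<le> real C}"
  have G [measurable]: "G \<in> sets ?M" unfolding G_def by measurable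
  have bounded_iff: "(\<exists>C::nat. \<forall>n. birkhoff digit_shift f n a \<le> real C) \<longleftrightarrow>
      (\<exists>C. \<forall>n. birkhoff digit_shift f n a \<le> C)" for a
    by (meson order_trans real_arch_simple)
  have inv: "digit_shift a \<in> G \<longleftrightarrow> a \<in> G" if a: "a \<in> space ?M" for a
  proof -
    have "(\<exists>C. \<forall>n. birkhoff digit_shift f n (digit_shift a) \<le> C) \<longleftrightarrow>
        (\<exists>C. \<forall>n. birkhoff digit_shift f n a \<le> C)"
    proof (intro iffI; elim exE)
      fix C assume C: "\<forall>n. birkhoff digit_shift f n (digit_shift a) \<le> C"
      have "birkhoff digit_shift f n a \<le> max 0 (f a + C)" for n
      proof (cases n)
        case (Suc m)
        then show ?thesis using C[rule_format, of m] by (simp add: birkhoff_Suc)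
      qed simp
      then show "\<exists>C. \<forall>n. birkhoff digit_shift f n a \<le> C" by blast
    next
      fix C assume C: "\<forall>n. birkhoff digit_shift f n a \<le> C"
      have "birkhoff digit_shift f n (digit_shift a) \<le> C - f a" for n
        using C[rule_format, of "Suc n"] by (simp add: birkhoff_Suc)
      then show "\<exists>C. \<forall>n. birkhoff digit_shift f n (digit_shift a) \<le> C" by blast
    qed
    moreover have "digit_shift a \<in> space ?M"
      using measurable_space[OF measurable_digit_shift a] .
    ultimately show ?thesis using a unfolding G_def bounded_iff by blast
  qed
  have "measure ?M G \<noteq> 0"
  proof
    assume "measure ?M G = 0"
    then have "AE a in ?M. a \<notin> G"
      using B.prob_eq_0[OF G] by simp
    then have "AE a in ?M. \<exists>n. 0 < birkhoff digit_shift f n a"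
    proof (rule AE_mp, intro AE_I2 impI)
      fix a assume a: "a \<in> space ?M" "a \<notin> G"
      then have "\<not> (\<forall>n. birkhoff digit_shift f n a \<le> real 0)"
        unfolding G_def by blast
      then show "\<exists>n. 0 < birkhoff digit_shift f n a" by (auto simp: not_le)
    qed
    then show False
      using maximal_ergodic_lemma[OF measurable_digit_shift distr_shift_bernoulli[OF p] f neg] by blast
  qed
  then have "measure ?M G = 1"
    using shift_invariant_0_1[OF p G inv] by blast
  then have "AE a in ?M. a \<in> G"
    using B.prob_eq_1[OF G] by simp
  then show ?thesis
    by (rule AE_mp, intro AE_I2 impI) (auto simp: G_def)
qed

text \<open>
  The mean of this function is the difference of \<open>s\<close> times the Lyapunov exponent and the entropy. Its
  \<open>n\<close>-th Birkhoff sum is the logarithm of the mass of the cylinder of order \<open>n\<close> divided by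
  \<open>cf_prod a n powr (2 * s)\<close>, that is, up to a bounded factor, by the \<open>s\<close>-th power of its length.
\<close>
definition dim_potential :: "(nat \<Rightarrow> real) \<Rightarrow> real \<Rightarrow> (nat \<Rightarrow> nat) \<Rightarrow> real" where
  "dim_potential p s a = ln (p (a 0)) + 2 * s * cf_log a"

lemma measurable_dim_potential [measurable]:
  "dim_potential q s \<in> borel_measurable (bernoulli_measure p)"
  unfolding dim_potential_def[abs_def] by measurable

lemma birkhoff_dim_potential:
  assumes "\<forall>k. 1 \<le> a k" "\<forall>k. 0 < p (a k)"
  shows "birkhoff digit_shift (dim_potential p s) n a
    = ln (\<Prod>k<n. p (a k)) - 2 * s * ln (cf_prod a n)"
proof -
  have "ln (\<Prod>k<n. p (a k)) = (\<Sum>k<n. ln (p (a k)))"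
    using assms by (intro ln_prod) (auto simp: less_imp_neq[symmetric])
  moreover have "ln (cf_prod a n) = - (\<Sum>k<n. cf_log ((digit_shift ^^ k) a))"
    using cf_prod_eq_exp[OF assms(1)] by simp
  ultimately show ?thesis
    by (simp add: birkhoff_def dim_potential_def sum.distrib sum_distrib_left)
qed

lemma prod_prob_le_1:
  fixes w :: "nat \<Rightarrow> nat"
  assumes p: "p \<in> prob_vectors" and w: "\<forall>k. 1 \<le> w k"
  shows "(\<Prod>k<n. p (w k)) \<le> 1"
proof -
  interpret B: prob_space "bernoulli_measure p" by (rule prob_space_bernoulli_measure[OF p])
  have "ennreal (\<Prod>k<n. p (w k)) \<le> 1"
    unfolding emeasure_bernoulli_cylinder[OF p w, symmetric] by (rule B.emeasure_le_1)
  then show ?thesis by simp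
qed

lemma geometric_tail_le:
  fixes \<rho> :: real
  assumes "0 \<le> \<rho>" "\<rho> < 1"
  shows "(\<Sum>n. if N \<le> n then ennreal ((\<rho> * \<rho>) ^ n) else 0) \<le> ennreal (\<rho> ^ N / (1 - \<rho>))"
proof -
  have "(\<Sum>n. if N \<le> n then ennreal ((\<rho> * \<rho>) ^ n) else 0) \<le> (\<Sum>n. ennreal (\<rho> ^ N * \<rho> ^ n))"
  proof (intro suminf_le)
    fix n
    have "N \<le> n \<Longrightarrow> \<rho> ^ n * \<rho> ^ n \<le> \<rho> ^ N * \<rho> ^ n"
      using assms by (intro mult_right_mono power_decreasing) auto
    then show "(if N \<le> n then ennreal ((\<rho> * \<rho>) ^ n) else 0) \<le> ennreal (\<rho> ^ N * \<rho> ^ n)"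
      using assms by (auto simp: power_mult_distrib intro!: ennreal_leI)
  qed auto
  also have "\<dots> = ennreal (\<rho> ^ N / (1 - \<rho>))"
  proof (rule suminf_ennreal_eq)
    show "(\<lambda>n. \<rho> ^ N * \<rho> ^ n) sums (\<rho> ^ N / (1 - \<rho>))"
      using sums_mult[OF geometric_sums[of \<rho>], of "\<rho> ^ N"] assms by simp
  qed (use assms in auto)
  finally show ?thesis .
qed

text \<open>
  A positive mean makes the Birkhoff sums grow linearly. Almost every sequence then lies, for all large
  \<open>n\<close>, in a cylinder whose mass exceeds the \<open>s\<close>-th power of its length exponentially, and since the
  masses of all cylinders of order \<open>n\<close> sum to \<open>1\<close>, such cylinders form covers with small \<open>s\<close>-sums.
  The truncation at \<open>K\<close> lets the statement apply to vectors of infinite entropy, where only the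
  truncated potential is integrable.
\<close>
theorem measure_dim_le:
  assumes p: "p \<in> prob_vectors" and s: "0 < s"
    and int: "integrable (bernoulli_measure p) (\<lambda>a. min (dim_potential p s a) K)"
    and pos: "0 < (\<integral>a. min (dim_potential p s a) K \<partial>bernoulli_measure p)"
  shows "measure_dim (cf_measure p) \<le> ennreal s"
proof -
  let ?M = "bernoulli_measure p"
  let ?X = "dim_potential p s"
  let ?S = "birkhoff digit_shift ?X"
  interpret B: prob_space ?M by (rule prob_space_bernoulli_measure[OF p])
  \<comment> \<open>The truncated mean is \<open>3 * \<delta>\<close>; sums growing like \<open>2 * \<delta> * n\<close> up to a constant eventually exceed \<open>\<delta> * n\<close>.\<close>
  define \<delta> where "\<delta> = (\<integral>a. min (?X a) K \<partial>?M) / 3"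
  have \<delta>: "0 < \<delta>" using pos by (simp add: \<delta>_def)
  define f where "f a = 2 * \<delta> - min (?X a) K" for a
  have "integrable ?M f" unfolding f_def using int by auto
  moreover have "(\<integral>a. f a \<partial>?M) < 0"
  proof -
    have "(\<integral>a. f a \<partial>?M) = 2 * \<delta> - 3 * \<delta>"
      unfolding f_def using int by (simp add: B.prob_space \<delta>_def)
    then show ?thesis using \<delta> by simp
  qed
  ultimately have bdd: "AE a in ?M. \<exists>C. \<forall>n. birkhoff digit_shift f n a \<le> C"
    by (rule birkhoff_shift_bounded_above[OF p])

  define G where "G n = {a \<in> space ?M. (\<forall>k. 0 < p (a k)) \<and> real n * \<delta> \<le> ?S n a}" for n
  have G_AE: "AE a in ?M. \<exists>N. \<forall>n\<ge>N. a \<in> G n"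
  proof -
    have "\<exists>N. \<forall>n\<ge>N. a \<in> G n"
      if a: "a \<in> space ?M" "\<forall>k. 0 < p (a k)" and C: "\<forall>n. birkhoff digit_shift f n a \<le> C" for a C
    proof -
      obtain N :: nat where N: "C / \<delta> \<le> real N" using real_arch_simple by blast
      have "real n * \<delta> \<le> ?S n a" if n: "N \<le> n" for n
      proof -
        have "C \<le> real n * \<delta>"
          using N n \<delta> by (simp add: divide_le_eq) (meson mult_right_mono less_imp_le of_nat_mono order_trans)
        moreover have "2 * real n * \<delta> - ?S n a \<le> birkhoff digit_shift f n a"
        proof -
          have "(\<Sum>k<n. 2 * \<delta> - ?X ((digit_shift ^^ k) a)) \<le> birkhoff digit_shift f n a"
            unfolding birkhoff_def f_def by (intro sum_mono) auto
          then show ?thesis by (simp add: birkhoff_def sum_subtractf)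
        qed
        ultimately show ?thesis using C[rule_format, of n] by linarith
      qed
      then show ?thesis using a by (auto simp: G_def)
    qed
    then have "AE a in ?M. (\<forall>k. 0 < p (a k)) \<longrightarrow> (\<exists>C. \<forall>n. birkhoff digit_shift f n a \<le> C)
        \<longrightarrow> (\<exists>N. \<forall>n\<ge>N. a \<in> G n)"
      by (intro AE_I2) blast
    from AE_mp[OF bdd AE_mp[OF AE_digit_pos[OF p] this]] show ?thesis .
  qed

  define code where "code n a = list_encode (map a [0..<n])" for n and a :: "nat \<Rightarrow> nat"
  have code_eq: "code n a = code n b \<longleftrightarrow> (\<forall>k<n. a k = b k)" for n a b
    by (auto simp: code_def list_encode_eq map_eq_conv)
  \<comment> \<open>Only the good sequences of a cylinder are covered: their images are close to each other by
    their own values of \<open>cf_prod\<close>. The closure makes the pieces Borel and keeps their diameters.\<close>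
  define U where "U n j = closure (cf_coding ` {a \<in> G n. code n a = j})" for n j

  have near: "dist (cf_coding a) (cf_coding b) \<le> ((\<Prod>k<n. p (a k)) * exp (- real n * \<delta>)) powr (1 / s)"
    if a: "a \<in> G n" and b: "b \<in> G n" and eq: "\<forall>k<n. a k = b k" for n a b
  proof -
    let ?P = "\<Prod>k<n. p (a k)"
    have P: "(\<Prod>k<n. p (b k)) = ?P" using eq by simp
    have P0: "0 < ?P" using a by (intro prod_pos) (simp add: G_def)
    have da: "\<forall>k. 1 \<le> a k" and db: "\<forall>k. 1 \<le> b k"
      using a b by (simp_all add: G_def space_bernoulli_measure)
    have "real n * \<delta> \<le> ln ?P - 2 * s * ln (cf_prod a n)"
      using a birkhoff_dim_potential[OF da, of p s n] by (simp add: G_def)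
    moreover have "real n * \<delta> \<le> ln ?P - 2 * s * ln (cf_prod b n)"
      using b birkhoff_dim_potential[OF db, of p s n] P by (simp add: G_def)
    ultimately have "s * (ln (cf_prod a n) + ln (cf_prod b n)) \<le> ln ?P - real n * \<delta>"
      by (simp add: algebra_simps)
    then have "ln (cf_prod a n * cf_prod b n) \<le> (1 / s) * (ln ?P - real n * \<delta>)"
      using s cf_prod_pos[OF da, of n] cf_prod_pos[OF db, of n] by (simp add: ln_mult field_simps)
    also have "\<dots> = ln ((?P * exp (- real n * \<delta>)) powr (1 / s))"
    proof -
      have "ln (?P * exp (- real n * \<delta>)) = ln ?P - real n * \<delta>"
        unfolding ln_mult_pos[OF P0 exp_gt_zero] by simp
      then show ?thesis by (simp only: ln_powr)
    qed
    finally have le: "ln (cf_prod a n * cf_prod b n) \<le> ln ((?P * exp (- real n * \<delta>)) powr (1 / s))" .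
    have "cf_prod a n * cf_prod b n \<le> (?P * exp (- real n * \<delta>)) powr (1 / s)"
    proof (rule iffD1[OF ln_le_cancel_iff, OF _ _ le])
      show "0 < cf_prod a n * cf_prod b n"
        using cf_prod_pos[OF da, of n] cf_prod_pos[OF db, of n] by (rule mult_pos_pos)
      have "0 < ?P * exp (- real n * \<delta>)" using P0 by (rule mult_pos_pos) simp
      then show "0 < (?P * exp (- real n * \<delta>)) powr (1 / s)" by (metis less_irrefl powr_gt_zero)
    qed
    then show ?thesis
      using cf_coding_diff_upper[OF da db eq] by (simp add: dist_real_def)
  qed

  have bounded_code: "bounded (cf_coding ` {a \<in> G n. code n a = j})" for n j
  proof (rule bounded_subset[of "{0..1}"])
    show "cf_coding ` {a \<in> G n. code n a = j} \<subseteq> {0..1}"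
      by (auto simp: G_def space_bernoulli_measure less_imp_le cf_coding_bounds)
  qed simp
  have bounded_U: "bounded (U n j)" for n j
    unfolding U_def by (intro bounded_closure bounded_code)

  have diam_U: "diameter (U n j) \<le> ((\<Prod>k<n. p (a k)) * exp (- real n * \<delta>)) powr (1 / s)"
    if a: "a \<in> G n" "code n a = j" for n j a
    unfolding U_def diameter_closure[OF bounded_code]
  proof (rule diameter_le)
    fix x y assume x: "x \<in> cf_coding ` {a \<in> G n. code n a = j}" and y: "y \<in> cf_coding ` {a \<in> G n. code n a = j}"
    obtain b where b: "x = cf_coding b" "b \<in> G n" "code n b = j" using x by blast
    obtain c where c: "y = cf_coding c" "c \<in> G n" "code n c = j" using y by blast
    have "\<forall>k<n. b k = c k" "\<forall>k<n. b k = a k"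
      using a(2) b(3) c(3) code_eq[of n b c] code_eq[of n b a] by auto
    then show "norm (x - y) \<le> ((\<Prod>k<n. p (a k)) * exp (- real n * \<delta>)) powr (1 / s)"
      using near[OF b(2) c(2)] b(1) c(1) by (simp add: dist_norm)
  qed simp

  have diam_power_U: "diam_power s (U n j)
      \<le> ennreal (exp (- real n * \<delta>)) * emeasure ?M {a \<in> space ?M. code n a = j}" for n j
  proof (cases "{a \<in> G n. code n a = j} = {}")
    case True
    then show ?thesis unfolding U_def by (simp only: image_empty closure_empty diam_power_def) simp
  next
    case False
    then obtain a where a: "a \<in> G n" "code n a = j" by blast
    then have da: "\<forall>k. 1 \<le> a k" by (simp add: G_def space_bernoulli_measure)
    let ?P = "\<Prod>k<n. p (a k)"
    have P0: "0 < ?P" using a by (intro prod_pos) (simp add: G_def)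
    have "diameter (U n j) powr s \<le> ((?P * exp (- real n * \<delta>)) powr (1 / s)) powr s"
      using diam_U[OF a] s by (intro powr_mono2 diameter_ge_0 bounded_U) auto
    also have "\<dots> = exp (- real n * \<delta>) * ?P"
      using s P0 by (simp add: powr_powr)
    finally have "diam_power s (U n j) \<le> ennreal (exp (- real n * \<delta>) * ?P)"
      using s by (auto simp: diam_power_def intro!: ennreal_leI)
    also have "\<dots> = ennreal (exp (- real n * \<delta>)) * ennreal ?P"
      using P0 by (simp add: ennreal_mult)
    also have "ennreal ?P = emeasure ?M {b \<in> space ?M. \<forall>k<n. b k = a k}"
      by (rule emeasure_bernoulli_cylinder[OF p da, symmetric])
    also have "{b \<in> space ?M. \<forall>k<n. b k = a k} = {b \<in> space ?M. code n b = j}"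
      using code_eq[of n _ a] a(2) by simp
    finally show ?thesis .
  qed

  have diam_U': "diameter (U n j) \<le> exp (- real n * \<delta> / s)" for n j
  proof (cases "{a \<in> G n. code n a = j} = {}")
    case True
    then show ?thesis unfolding U_def by (simp only: image_empty closure_empty diameter_empty) simp
  next
    case False
    then obtain a where a: "a \<in> G n" "code n a = j" by blast
    then have da: "\<forall>k. 1 \<le> a k" by (simp add: G_def space_bernoulli_measure)
    have P0: "0 < (\<Prod>k<n. p (a k))" using a by (intro prod_pos) (simp add: G_def)
    have "diameter (U n j) \<le> ((\<Prod>k<n. p (a k)) * exp (- real n * \<delta>)) powr (1 / s)"
      by (rule diam_U[OF a])
    also have "\<dots> \<le> (1 * exp (- real n * \<delta>)) powr (1 / s)"
      using P0 s prod_prob_le_1[OF p da] by (intro powr_mono2 mult_right_mono) auto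
    also have "\<dots> = exp (- real n * \<delta> / s)"
      by (simp add: powr_def)
    finally show ?thesis .
  qed

  define A where "A = (\<Inter>N. \<Union>n\<in>{N..}. \<Union>j. U n j)"
  have A_borel: "A \<in> sets borel"
    unfolding A_def U_def by measurable
  have "emeasure (cf_measure p) A = 1"
  proof -
    interpret C: prob_space "cf_measure p" by (rule prob_space_cf_measure[OF p])
    have "AE a in ?M. cf_coding a \<in> A"
      using G_AE
    proof (rule AE_mp, intro AE_I2 impI)
      fix a assume "\<exists>N. \<forall>n\<ge>N. a \<in> G n"
      then obtain N where N: "\<And>n. N \<le> n \<Longrightarrow> a \<in> G n" by blast
      have "cf_coding a \<in> U n (code n a)" if "N \<le> n" for n
        unfolding U_def using N[OF that] by (intro subsetD[OF closure_subset]) blast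
      then have "cf_coding a \<in> (\<Union>n\<in>{m..}. \<Union>j. U n j)" for m
        by (intro UN_I[of "max N m"] UN_I[of "code (max N m) a"]) auto
      then show "cf_coding a \<in> A" unfolding A_def by blast
    qed
    then have "AE x in cf_measure p. x \<in> A"
      unfolding cf_measure_def using A_borel by (subst AE_distr_iff) auto
    then show ?thesis
      using A_borel by (subst C.emeasure_eq_1_AE) (auto simp: cf_measure_def)
  qed

  \<comment> \<open>A square root of the decay rate: one factor \<open>\<rho> ^ n\<close> makes the tail small, the other summable.\<close>
  define \<rho> where "\<rho> = exp (- \<delta> / 2)"
  have \<rho>: "0 < \<rho>" "\<rho> < 1" using \<delta> by (auto simp: \<rho>_def)
  have \<rho>_sq: "(\<rho> * \<rho>) ^ n = exp (- real n * \<delta>)" for n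
    by (simp add: \<rho>_def exp_add[symmetric] exp_of_nat_mult[symmetric])

  have "hausdorff_premeasure d s A = 0" if d: "0 < d" for d
  proof -
    have "(\<lambda>n. exp (- real n * \<delta> / s)) \<longlonglongrightarrow> 0"
      using \<delta> s by real_asymp
    then have "eventually (\<lambda>n. exp (- real n * \<delta> / s) < d) sequentially"
      using d by (rule order_tendstoD)
    then obtain N0 where N0: "\<And>n. N0 \<le> n \<Longrightarrow> exp (- real n * \<delta> / s) < d"
      by (auto simp: eventually_sequentially)
    have le: "hausdorff_premeasure d s A \<le> ennreal (\<rho> ^ N / (1 - \<rho>))" if N: "N0 \<le> N" for N
    proof -
      define V where "V = (\<lambda>(n, j). if N \<le> n then U n j else {})"
      have V: "V (n, j) = (if N \<le> n then U n j else {})" for n j by (simp add: V_def)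
      have cover: "A \<subseteq> (\<Union>i. V (prod_decode i))"
      proof
        fix x assume "x \<in> A"
        then obtain n j where "N \<le> n" "x \<in> U n j" unfolding A_def by blast
        then have "x \<in> V (prod_decode (prod_encode (n, j)))" by (simp add: V)
        then show "x \<in> (\<Union>i. V (prod_decode i))" by blast
      qed
      have small: "bounded (V z) \<and> diameter (V z) \<le> d" for z
      proof (cases z)
        case (Pair n j)
        then show ?thesis
          using bounded_U diam_U'[of n j] N0[of n] N d by (auto simp: V)
      qed
      have "hausdorff_premeasure d s A \<le> (\<Sum>i. diam_power s (V (prod_decode i)))"
        unfolding hausdorff_premeasure_def using cover small
        by (intro INF_lower2[of "\<lambda>i. V (prod_decode i)"]) auto
      also have "\<dots> = (\<Sum>n. \<Sum>j. diam_power s (V (n, j)))"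
        by (rule suminf_ennreal_2dimen) simp
      also have "\<dots> \<le> (\<Sum>n. if N \<le> n then ennreal ((\<rho> * \<rho>) ^ n) else 0)"
      proof (intro suminf_le)
        fix n
        show "(\<Sum>j. diam_power s (V (n, j))) \<le> (if N \<le> n then ennreal ((\<rho> * \<rho>) ^ n) else 0)"
        proof (cases "N \<le> n")
          case True
          have "(\<Sum>j. diam_power s (V (n, j)))
              \<le> (\<Sum>j. ennreal (exp (- real n * \<delta>)) * emeasure ?M {a \<in> space ?M. code n a = j})"
            using True diam_power_U by (intro suminf_le) (auto simp: V)
          also have "\<dots> = ennreal (exp (- real n * \<delta>)) * (\<Sum>j. emeasure ?M {a \<in> space ?M. code n a = j})"
            by simp
          also have "(\<Sum>j. emeasure ?M {a \<in> space ?M. code n a = j})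
              = emeasure ?M (\<Union>j. {a \<in> space ?M. code n a = j})"
          proof (rule suminf_emeasure)
            have "code n \<in> measurable ?M (count_space UNIV)"
            proof -
              have "(\<lambda>a. map a [0..<n]) \<in> measurable ?M (count_space UNIV)"
              proof (induction n)
                case (Suc n)
                note Suc [measurable]
                show ?case by simp
              qed simp
              then show ?thesis unfolding code_def by (rule measurable_compose) simp
            qed
            then show "range (\<lambda>j. {a \<in> space ?M. code n a = j}) \<subseteq> sets ?M" by auto
          qed (auto simp: disjoint_family_on_def)
          also have "ennreal (exp (- real n * \<delta>)) * emeasure ?M (\<Union>j. {a \<in> space ?M. code n a = j})
              \<le> ennreal (exp (- real n * \<delta>)) * 1"
            by (intro mult_left_mono B.emeasure_le_1) simp
          finally show ?thesis using True by (simp add: \<rho>_sq)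
        next
          case False
          then show ?thesis by (simp add: V diam_power_def)
        qed
      qed auto
      also have "\<dots> \<le> ennreal (\<rho> ^ N / (1 - \<rho>))"
        using \<rho> by (intro geometric_tail_le) auto
      finally show ?thesis .
    qed
    have "(\<lambda>N. ennreal (\<rho> ^ N / (1 - \<rho>))) \<longlonglongrightarrow> ennreal (0 / (1 - \<rho>))"
      using \<rho> by (intro tendsto_ennrealI tendsto_intros LIMSEQ_realpow_zero) auto
    then have "hausdorff_premeasure d s A \<le> ennreal (0 / (1 - \<rho>))"
      by (rule LIMSEQ_le_const) (use le in blast)
    then show ?thesis by simp
  qed
  then have "hausdorff_measure s A = 0"
    unfolding hausdorff_measure_def by simp
  then have "hausdorff_dim A \<le> ennreal s"
    unfolding hausdorff_dim_def using s by (intro INF_lower) auto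
  then show ?thesis
    unfolding measure_dim_def using A_borel \<open>emeasure (cf_measure p) A = 1\<close>
    by (intro INF_lower2[of A]) auto
qed

section \<open>Dimension bounded from below\<close>

text \<open>
  A mass distribution argument. A negative mean bounds the mass of cylinders by the \<open>s\<close>-th power of
  their size on a set \<open>E c\<close> of positive probability. A set \<open>V\<close> meeting the image of \<open>E c\<close> in at least
  two points has a diameter controlled from below by the first disagreement of their digits, while all
  of its preimage in \<open>E c\<close> lies in the cylinder of the common prefix. So the mass that \<open>V\<close> carries is at
  most a constant times \<open>diameter V powr s\<close>.
\<close>
theorem measure_dim_ge:
  assumes p: "p \<in> prob_vectors" and s: "0 < s"
    and int: "integrable (bernoulli_measure p) (dim_potential p s)"
    and log_int: "integrable (bernoulli_measure p) cf_log"
    and neg: "(\<integral>a. dim_potential p s a \<partial>bernoulli_measure p) < 0"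
  shows "ennreal s \<le> measure_dim (cf_measure p)"
proof -
  let ?M = "bernoulli_measure p"
  let ?\<sigma> = digit_shift
  interpret B: prob_space ?M by (rule prob_space_bernoulli_measure[OF p])
  \<comment> \<open>The same mean as the potential by invariance, but with \<open>cf_log\<close> evaluated two digits later, so
    that Birkhoff sums of order \<open>n\<close> contain \<open>cf_prod a (n + 2)\<close>, as in the lower bound for distances.\<close>
  define f where "f a = dim_potential p s a - 2 * s * cf_log a + 2 * s * cf_log (?\<sigma> (?\<sigma> a))" for a
  have log2: "integrable ?M (\<lambda>a. cf_log (?\<sigma> a))" "integrable ?M (\<lambda>a. cf_log (?\<sigma> (?\<sigma> a)))"
    using integrable_invariant[OF measurable_digit_shift distr_shift_bernoulli[OF p]] log_int by blast+
  have "(\<integral>a. cf_log (?\<sigma> (?\<sigma> a)) \<partial>?M) = (\<integral>a. cf_log a \<partial>?M)"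
    using integral_invariant[OF measurable_digit_shift distr_shift_bernoulli[OF p], of "\<lambda>a. cf_log (?\<sigma> a)"]
      integral_invariant[OF measurable_digit_shift distr_shift_bernoulli[OF p], of cf_log] by simp
  then have "(\<integral>a. f a \<partial>?M) < 0"
    unfolding f_def using int log_int log2 neg by simp
  moreover have f_int: "integrable ?M f"
    unfolding f_def using int log_int log2 by auto
  ultimately have bdd: "AE a in ?M. \<exists>C. \<forall>n. birkhoff ?\<sigma> f n a \<le> C"
    by (intro birkhoff_shift_bounded_above[OF p])
  have [measurable]: "f \<in> borel_measurable ?M" using f_int by auto

  define g where "g a = 2 * s * (cf_log a + cf_log (?\<sigma> a))" for a
  have [measurable]: "g \<in> borel_measurable ?M" unfolding g_def by measurable
  define E where "E c = {a \<in> space ?M. (\<forall>k. 0 < p (a k)) \<and> (\<forall>n. birkhoff ?\<sigma> f n a + g a \<le> real c)}" for c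
  have E [measurable]: "E c \<in> sets ?M" for c unfolding E_def by measurable
  have f_sum: "birkhoff ?\<sigma> f n a + g a = ln (\<Prod>k<n. p (a k)) - 2 * s * ln (cf_prod a (n + 2))"
    if a: "\<forall>k. 1 \<le> a k" "\<forall>k. 0 < p (a k)" for n a
  proof -
    let ?L = "\<lambda>k. cf_log ((?\<sigma> ^^ k) a)"
    have "(\<Sum>k<n + 2. ?L k) = ?L 0 + ?L 1 + (\<Sum>k<n. ?L (Suc (Suc k)))"
      by (simp add: sum.lessThan_Suc_shift del: sum.lessThan_Suc)
    then have Q: "ln (cf_prod a (n + 2)) = - (cf_log a + cf_log (?\<sigma> a) + (\<Sum>k<n. ?L (Suc (Suc k))))"
      using cf_prod_eq_exp[OF a(1), of "n + 2"] by simp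
    have "birkhoff ?\<sigma> f n a = birkhoff ?\<sigma> (dim_potential p s) n a
        - 2 * s * (\<Sum>k<n. ?L k) + 2 * s * (\<Sum>k<n. ?L (Suc (Suc k)))"
      by (simp add: birkhoff_def f_def sum.distrib sum_subtractf sum_distrib_left)
    then have "birkhoff ?\<sigma> f n a = ln (\<Prod>k<n. p (a k)) + 2 * s * (\<Sum>k<n. ?L (Suc (Suc k)))"
      using cf_prod_eq_exp[OF a(1), of n] by (simp add: birkhoff_dim_potential[OF a])
    moreover have "x + 2 * s * t + 2 * s * (u + v) = x - 2 * s * - (u + v + t)" for x t u v
      by (simp add: algebra_simps)
    ultimately show ?thesis unfolding Q g_def by (simp only:)
  qed
  have E_bound: "(\<Prod>k<n. p (a k)) \<le> exp (real c) * cf_prod a (n + 2) powr (2 * s)"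
    if a: "a \<in> E c" for a n c
  proof -
    have da: "\<forall>k. 1 \<le> a k" and pa: "\<forall>k. 0 < p (a k)"
      using a by (auto simp: E_def space_bernoulli_measure)
    have "0 < (\<Prod>k<n. p (a k))" using pa by (intro prod_pos) simp
    then have "(\<Prod>k<n. p (a k)) = exp (ln (\<Prod>k<n. p (a k)))" by simp
    also have "ln (\<Prod>k<n. p (a k)) \<le> real c + 2 * s * ln (cf_prod a (n + 2))"
    proof -
      have "birkhoff ?\<sigma> f n a + g a \<le> real c" using a by (simp add: E_def)
      then show ?thesis unfolding f_sum[OF da pa] by linarith
    qed
    also have "exp (real c + 2 * s * ln (cf_prod a (n + 2))) = exp (real c) * cf_prod a (n + 2) powr (2 * s)"
      using cf_prod_pos[OF da, of "n + 2"] by (simp add: exp_add powr_def)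
    finally show ?thesis by simp
  qed

  have "\<exists>c. emeasure ?M (E c) \<noteq> 0"
  proof (rule ccontr)
    assume "\<nexists>c. emeasure ?M (E c) \<noteq> 0"
    then have "AE a in ?M. \<forall>c. a \<notin> E c"
      unfolding AE_all_countable by (intro allI AE_not_in) (auto simp: null_sets_def)
    then have "AE a in ?M. False"
      using bdd AE_digit_pos[OF p] AE_space
    proof eventually_elim
      case (elim a)
      then obtain C where C: "\<forall>n. birkhoff ?\<sigma> f n a \<le> C" by blast
      obtain c :: nat where "C + g a \<le> real c" using real_arch_simple by blast
      then have "birkhoff ?\<sigma> f n a + g a \<le> real c" for n
        using C[rule_format, of n] by linarith
      then have "a \<in> E c" using elim by (simp add: E_def)
      then show ?case using elim by blast
    qed
    then show False by simp
  qed
  then obtain c where c: "emeasure ?M (E c) \<noteq> 0" by blast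

  have cover_piece: "\<exists>C\<in>sets ?M. {a \<in> E c. cf_coding a \<in> V} \<subseteq> C
      \<and> emeasure ?M C \<le> ennreal (exp (real c)) * diam_power t V"
    if t: "0 \<le> t" "t < s" and V: "bounded V" "diameter V \<le> 1" for t V
  proof -
    define S where "S = {a \<in> E c. cf_coding a \<in> V}"
    have S_digit: "\<forall>k. 1 \<le> a k" if "a \<in> S" for a
      using that by (auto simp: S_def E_def space_bernoulli_measure)
    have S_space: "S \<subseteq> space ?M" by (auto simp: S_def E_def)
    consider "S = {}" | a where "S = {a}" | a b where "a \<in> S" "b \<in> S" "a \<noteq> b" by blast
    then show ?thesis
    proof cases
      case 1
      then show ?thesis by (intro bexI[of _ "{}"]) (auto simp: S_def)
    next
      \<comment> \<open>A single point carries no mass, since the cylinders around it shrink in mass.\<close>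
      case (2 a)
      then have a: "a \<in> E c" by (auto simp: S_def)
      have da: "\<forall>k. 1 \<le> a k" using S_digit 2 by simp
      define C where "C = {b \<in> space ?M. \<forall>k. b k = a k}"
      have C: "C \<in> sets ?M" unfolding C_def by measurable
      have "emeasure ?M C \<le> ennreal (exp (real c) * ((1 / 2) ^ Suc n) powr (2 * s))" for n
      proof -
        have "emeasure ?M C \<le> emeasure ?M {b \<in> space ?M. \<forall>k<2 * n. b k = a k}"
          by (rule emeasure_mono) (auto simp: C_def)
        also have "\<dots> = ennreal (\<Prod>k<2 * n. p (a k))"
          by (rule emeasure_bernoulli_cylinder[OF p da])
        also have "\<dots> \<le> ennreal (exp (real c) * ((1 / 2) ^ Suc n) powr (2 * s))"
        proof (rule ennreal_leI)
          have "(\<Prod>k<2 * n. p (a k)) \<le> exp (real c) * cf_prod a (2 * n + 2) powr (2 * s)"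
            by (rule E_bound[OF a])
          also have "cf_prod a (2 * n + 2) powr (2 * s) \<le> ((1 / 2) ^ Suc n) powr (2 * s)"
            using cf_prod_halves[OF da, of "Suc n"] cf_prod_pos[OF da, of "2 * n + 2"] s
            by (intro powr_mono2) auto
          finally show "(\<Prod>k<2 * n. p (a k)) \<le> exp (real c) * ((1 / 2) ^ Suc n) powr (2 * s)"
            by simp
        qed
        finally show ?thesis .
      qed
      moreover have "(\<lambda>n. ennreal (exp (real c) * ((1 / 2) ^ Suc n) powr (2 * s))) \<longlonglongrightarrow> ennreal 0"
        using s by (intro tendsto_ennrealI) real_asymp
      ultimately have "emeasure ?M C \<le> ennreal 0"
        by (intro LIMSEQ_le_const) auto
      moreover have "S \<subseteq> C" using 2 S_space by (auto simp: C_def)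
      ultimately show ?thesis using C by (intro bexI[of _ C]) (auto simp: S_def)
    next
      case (3 a0 b0)
      define n where "n = (LEAST n. \<exists>a\<in>S. \<exists>b\<in>S. a n \<noteq> b n)"
      have "\<exists>n. \<exists>a\<in>S. \<exists>b\<in>S. a n \<noteq> b n" using 3 by (meson ext)
      then have "\<exists>a\<in>S. \<exists>b\<in>S. a n \<noteq> b n" unfolding n_def by (rule LeastI_ex)
      then obtain a b where ab: "a \<in> S" "b \<in> S" "a n \<noteq> b n" by blast
      have agree: "x k = y k" if "x \<in> S" "y \<in> S" "k < n" for x y k
        using not_less_Least[of k "\<lambda>n. \<exists>a\<in>S. \<exists>b\<in>S. a n \<noteq> b n"] that unfolding n_def by blast
      note da = S_digit[OF ab(1)] and db = S_digit[OF ab(2)]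
      define C where "C = {x \<in> space ?M. \<forall>k<n. x k = a k}"
      define P where "P = (\<Prod>k<n. p (a k))"
      define Q where "Q = cf_prod a (n + 2) * cf_prod b (n + 2)"
      have C: "C \<in> sets ?M" unfolding C_def by measurable
      have SC: "S \<subseteq> C" using S_space agree ab(1) by (auto simp: C_def)
      have P0: "0 \<le> P" unfolding P_def using p da by (intro prod_nonneg) (auto simp: prob_vectors_def)
      have Q0: "0 < Q" unfolding Q_def using cf_prod_pos da db by simp
      have "P \<le> exp (real c) * cf_prod a (n + 2) powr (2 * s)"
        unfolding P_def by (rule E_bound) (use ab in \<open>simp add: S_def\<close>)
      moreover have "P \<le> exp (real c) * cf_prod b (n + 2) powr (2 * s)"
      proof -
        have "P = (\<Prod>k<n. p (b k))" unfolding P_def using agree[OF ab(1,2)] by simp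
        then show ?thesis using E_bound[of b c n] ab by (simp add: S_def)
      qed
      ultimately have "P * P \<le> (exp (real c) * cf_prod a (n + 2) powr (2 * s))
          * (exp (real c) * cf_prod b (n + 2) powr (2 * s))"
        using P0 by (intro mult_mono) auto
      also have "\<dots> = (exp (real c) * Q powr s) * (exp (real c) * Q powr s)"
        using cf_prod_pos[OF da, of "n + 2"] cf_prod_pos[OF db, of "n + 2"]
        by (simp add: Q_def powr_mult powr_add[symmetric] mult_ac)
      finally have "P \<le> exp (real c) * Q powr s"
        using P0 by (metis abs_le_square_iff abs_of_nonneg exp_ge_zero mult_nonneg_nonneg power2_eq_square powr_ge_zero)
      also have dV: "Q \<le> diameter V"
      proof -
        have "Q \<le> dist (cf_coding a) (cf_coding b)"
          unfolding Q_def dist_real_def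
          by (rule cf_coding_diff_lower[OF da db _ ab(3)]) (use agree ab in blast)
        also have "\<dots> \<le> diameter V"
          using ab by (intro diameter_bounded_bound V) (auto simp: S_def)
        finally show ?thesis .
      qed
      then have "exp (real c) * Q powr s \<le> exp (real c) * diameter V powr s"
        using Q0 s by (intro mult_left_mono powr_mono2) auto
      also have "diameter V powr s \<le> diameter V powr t"
        using dV Q0 V t by (intro powr_mono') auto
      finally have "P \<le> exp (real c) * diameter V powr t"
        by simp
      then have "ennreal P \<le> ennreal (exp (real c)) * ennreal (diameter V powr t)"
        by (simp add: ennreal_mult[symmetric])
      also have "ennreal (diameter V powr t) \<le> diam_power t V"
        using ab dV Q0 by (auto simp: diam_power_def S_def)
      finally have "ennreal P \<le> ennreal (exp (real c)) * diam_power t V"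
        by (simp add: mult_left_mono)
      moreover have "emeasure ?M C = ennreal P"
        unfolding C_def P_def by (rule emeasure_bernoulli_cylinder[OF p da])
      ultimately show ?thesis using C SC by (intro bexI[of _ C]) (auto simp: S_def)
    qed
  qed

  have pos: "hausdorff_measure t A \<noteq> 0"
    if A: "A \<in> sets borel" "emeasure (cf_measure p) A = 1" and t: "0 \<le> t" "t < s" for A t
  proof -
    interpret C: prob_space "cf_measure p" by (rule prob_space_cf_measure[OF p])
    have [measurable]: "A \<in> sets borel" by fact
    have "AE x in cf_measure p. x \<in> A"
      using A by (intro C.AE_prob_1) (simp add: measure_def)
    then have in_A: "AE a in ?M. cf_coding a \<in> A"
      unfolding cf_measure_def by (subst (asm) AE_distr_iff) auto
    have "ennreal (exp (- real c)) * emeasure ?M (E c) \<le> hausdorff_premeasure 1 t A"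
      unfolding hausdorff_premeasure_def
    proof (rule INF_greatest)
      fix V :: "nat \<Rightarrow> real set"
      assume "V \<in> {U. A \<subseteq> (\<Union>i. U i) \<and> (\<forall>i. bounded (U i) \<and> diameter (U i) \<le> 1)}"
      then have V: "A \<subseteq> (\<Union>i. V i)" "\<And>i. bounded (V i)" "\<And>i. diameter (V i) \<le> 1" by auto
      have "\<forall>i. \<exists>C. C \<in> sets ?M \<and> {a \<in> E c. cf_coding a \<in> V i} \<subseteq> C
          \<and> emeasure ?M C \<le> ennreal (exp (real c)) * diam_power t (V i)"
        by (intro allI cover_piece[OF t V(2,3), unfolded Bex_def])
      from choice[OF this] obtain C where C': "\<forall>i. C i \<in> sets ?M \<and> {a \<in> E c. cf_coding a \<in> V i} \<subseteq> C i
          \<and> emeasure ?M (C i) \<le> ennreal (exp (real c)) * diam_power t (V i)" ..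
      note C = C'[rule_format, THEN conjunct1] C'[rule_format, THEN conjunct2, THEN conjunct1]
        C'[rule_format, THEN conjunct2, THEN conjunct2]
      have "emeasure ?M (E c) \<le> emeasure ?M (\<Union>i. C i)"
      proof (rule emeasure_mono_AE)
        show "AE a in ?M. a \<in> E c \<longrightarrow> a \<in> (\<Union>i. C i)"
          using in_A
        proof eventually_elim
          case (elim a)
          then show ?case using V(1) C(2) by blast
        qed
      qed (use C(1) in auto)
      also have "\<dots> \<le> (\<Sum>i. emeasure ?M (C i))"
        using C(1) by (intro emeasure_subadditive_countably) auto
      also have "\<dots> \<le> (\<Sum>i. ennreal (exp (real c)) * diam_power t (V i))"
        by (intro suminf_le C(3)) auto
      also have "\<dots> = ennreal (exp (real c)) * (\<Sum>i. diam_power t (V i))" by simp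
      finally have "ennreal (exp (- real c)) * emeasure ?M (E c)
          \<le> ennreal (exp (- real c)) * (ennreal (exp (real c)) * (\<Sum>i. diam_power t (V i)))"
        by (rule mult_left_mono) simp
      also have "\<dots> = (ennreal (exp (- real c)) * ennreal (exp (real c))) * (\<Sum>i. diam_power t (V i))"
        by (simp only: mult.assoc)
      also have "ennreal (exp (- real c)) * ennreal (exp (real c)) = 1"
        by (simp add: ennreal_mult[symmetric] exp_minus)
      finally show "ennreal (exp (- real c)) * emeasure ?M (E c) \<le> (\<Sum>i. diam_power t (V i))"
        by simp
    qed
    also have "\<dots> \<le> hausdorff_measure t A"
      unfolding hausdorff_measure_def by (rule SUP_upper) simp
    finally show ?thesis using c by auto
  qed
  show ?thesis
    unfolding measure_dim_def hausdorff_dim_def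
  proof (intro INF_greatest)
    fix A t
    assume A: "A \<in> {A \<in> sets borel. emeasure (cf_measure p) A = 1}"
      and t: "t \<in> {t. 0 \<le> t \<and> hausdorff_measure t A = 0}"
    then have "\<not> t < s" using pos[of A t] by auto
    then show "ennreal s \<le> ennreal t" by (auto intro: ennreal_leI)
  qed
qed

section \<open>The mean potential as a functional of the probability vector\<close>

text \<open>
  Summing \<open>u * ln u + 2 * s * u * ln i\<close> over the digits \<open>i\<close> with \<open>u = p i\<close> gives the part of the mean
  potential that depends on single digits only. The summand \<open>i powr (- 2 * s)\<close> makes every term
  nonnegative, and for \<open>s > 1 / 2\<close> its total is finite; this is where \<open>1 / 2\<close> enters the proof.
\<close>
definition entropy_term :: "real \<Rightarrow> nat \<Rightarrow> real \<Rightarrow> real" where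
  "entropy_term s i u = u * ln u + 2 * s * u * ln (real i) + real i powr (- 2 * s)"

text \<open>
  This is \<open>ln x \<le> x - 1\<close> at \<open>x = i powr (- 2 * s) / u\<close>.
\<close>
lemma entropy_term_nonneg:
  assumes "1 \<le> i" "0 \<le> u"
  shows "0 \<le> entropy_term s i u"
proof (cases "u = 0")
  case False
  then have u: "0 < u" using assms by simp
  define w where "w = real i powr (- 2 * s)"
  have w: "0 < w" using assms by (simp add: w_def)
  have "ln (w / u) \<le> w / u - 1"
    using u w by (intro ln_le_minus_one) simp
  moreover have "ln (w / u) = - 2 * s * ln (real i) - ln u"
    using u w assms by (simp add: ln_div) (simp add: w_def)
  ultimately have "u * (- 2 * s * ln (real i) - ln u) \<le> u * (w / u - 1)"
    using u by (intro mult_left_mono) auto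
  then have "- 2 * s * u * ln (real i) - u * ln u \<le> w - u"
    using u by (simp add: algebra_simps)
  then have "0 \<le> u * ln u + 2 * s * u * ln (real i) + w" using u by simp
  then show ?thesis unfolding entropy_term_def w_def .
qed (simp add: entropy_term_def)

definition zeta_sum :: "real \<Rightarrow> ennreal" where
  "zeta_sum s = (\<Sum>i. ennreal (real (Suc i) powr (- 2 * s)))"

lemma zeta_sum_finite:
  assumes "1 / 2 < s"
  shows "zeta_sum s < \<infinity>"
proof -
  have "summable (\<lambda>i. real i powr (- 2 * s))"
    using assms by (subst summable_real_powr_iff) simp
  then have "summable (\<lambda>i. real (Suc i) powr (- 2 * s))"
    by (subst summable_Suc_iff)
  then show ?thesis
    unfolding zeta_sum_def by (simp add: suminf_ennreal2 less_top[symmetric])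
qed

text \<open>
  The part of \<open>cf_log\<close> not explained by the first digit; it lies between \<open>0\<close> and \<open>ln 2\<close>.
\<close>
definition cf_excess :: "(nat \<Rightarrow> nat) \<Rightarrow> real" where
  "cf_excess a = cf_log a - ln (real (a 0))"

lemma measurable_cf_excess [measurable]: "cf_excess \<in> borel_measurable (bernoulli_measure p)"
  unfolding cf_excess_def[abs_def] by measurable

lemma cf_excess_nonneg: "\<forall>k. 1 \<le> a k \<Longrightarrow> 0 \<le> cf_excess a"
  unfolding cf_excess_def using cf_log_bounds(1)[of a] by simp

text \<open>
  The mean of \<open>dim_potential p s\<close>, shifted by \<open>zeta_sum s\<close> and arranged as a sum of nonnegative
  quantities. It is therefore defined for every vector, Fatou's lemma applies to it, and "the mean
  potential is at most \<open>0\<close>" becomes \<open>energy s p \<le> zeta_sum s\<close>, also when the potential is not integrable.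
\<close>
definition energy :: "real \<Rightarrow> (nat \<Rightarrow> real) \<Rightarrow> ennreal" where
  "energy s p = (\<Sum>i. ennreal (entropy_term s (Suc i) (p (Suc i))))
     + ennreal (2 * s) * (\<integral>\<^sup>+a. ennreal (cf_excess a) \<partial>bernoulli_measure p)"

definition digit_weight :: "real \<Rightarrow> (nat \<Rightarrow> real) \<Rightarrow> nat \<Rightarrow> real" where
  "digit_weight s p i = real i powr (- 2 * s) / p i"

lemma dim_potential_plus_weight:
  assumes a: "\<forall>k. 1 \<le> a k" and pos: "0 < p (a 0)"
  shows "dim_potential p s a + digit_weight s p (a 0)
    = entropy_term s (a 0) (p (a 0)) / p (a 0) + 2 * s * cf_excess a"
  using pos by (simp add: dim_potential_def digit_weight_def entropy_term_def cf_excess_def field_simps)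

text \<open>
  The remainder \<open>r\<close> collects the summands \<open>i powr (- 2 * s)\<close> of the digits of probability \<open>0\<close>: they
  occur in \<open>energy\<close> and in \<open>zeta_sum\<close> but are invisible to the integrals.
\<close>
lemma energy_split:
  assumes p: "p \<in> prob_vectors" and s: "1 / 2 < s"
  obtains r where "r < \<infinity>"
    "energy s p = (\<integral>\<^sup>+a. ennreal (dim_potential p s a + digit_weight s p (a 0)) \<partial>bernoulli_measure p) + r"
    "zeta_sum s = (\<integral>\<^sup>+a. ennreal (digit_weight s p (a 0)) \<partial>bernoulli_measure p) + r"
proof
  let ?M = "bernoulli_measure p"
  have p0: "0 \<le> p (Suc i)" for i using p by (simp add: prob_vectors_def)
  define e where "e i = (if p (Suc i) = 0 then ennreal (real (Suc i) powr (- 2 * s)) else 0)" for i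
  have ew: "ennreal (p (Suc i)) * ennreal (digit_weight s p (Suc i)) + e i
      = ennreal (real (Suc i) powr (- 2 * s))" for i
    using p0[of i] by (auto simp: e_def digit_weight_def ennreal_mult[symmetric])
  have ee: "ennreal (p (Suc i)) * ennreal (entropy_term s (Suc i) (p (Suc i)) / p (Suc i)) + e i
      = ennreal (entropy_term s (Suc i) (p (Suc i)))" for i
    using p0[of i] entropy_term_nonneg[of "Suc i" "p (Suc i)" s]
    by (cases "p (Suc i) = 0") (simp_all add: e_def entropy_term_def ennreal_mult[symmetric])
  show z: "zeta_sum s = (\<integral>\<^sup>+a. ennreal (digit_weight s p (a 0)) \<partial>?M) + (\<Sum>i. e i)"
    unfolding zeta_sum_def nn_integral_bernoulli_digit[OF p, of "\<lambda>i. ennreal (digit_weight s p i)"] ew[symmetric]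
    by (intro suminf_add[symmetric] summableI)
  show "(\<Sum>i. e i) < \<infinity>"
    using zeta_sum_finite[OF s] unfolding z by (simp add: ennreal_add_less_top)
  have "(\<integral>\<^sup>+a. ennreal (dim_potential p s a + digit_weight s p (a 0)) \<partial>?M)
      = (\<integral>\<^sup>+a. ennreal (entropy_term s (a 0) (p (a 0)) / p (a 0)) + ennreal (2 * s) * ennreal (cf_excess a) \<partial>?M)"
  proof (rule nn_integral_cong_AE, rule AE_mp[OF AE_digit_pos[OF p]], intro AE_I2 impI)
    fix a assume a: "a \<in> space ?M" "\<forall>k. 0 < p (a k)"
    then have da: "\<forall>k. 1 \<le> a k" by (simp add: space_bernoulli_measure)
    have pa: "0 < p (a 0)" using a by simp
    have "0 \<le> entropy_term s (a 0) (p (a 0)) / p (a 0)"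
      using entropy_term_nonneg[of "a 0" "p (a 0)" s] da pa by (intro divide_nonneg_pos) auto
    then show "ennreal (dim_potential p s a + digit_weight s p (a 0))
        = ennreal (entropy_term s (a 0) (p (a 0)) / p (a 0)) + ennreal (2 * s) * ennreal (cf_excess a)"
      unfolding dim_potential_plus_weight[where a = a and p = p, OF da pa]
      using cf_excess_nonneg[OF da] s by (simp add: ennreal_mult[symmetric])
  qed
  also have "\<dots> = (\<integral>\<^sup>+a. ennreal (entropy_term s (a 0) (p (a 0)) / p (a 0)) \<partial>?M)
      + ennreal (2 * s) * (\<integral>\<^sup>+a. ennreal (cf_excess a) \<partial>?M)"
    by (subst nn_integral_add) (simp_all add: nn_integral_cmult)
  also have "(\<integral>\<^sup>+a. ennreal (entropy_term s (a 0) (p (a 0)) / p (a 0)) \<partial>?M)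
      = (\<Sum>i. ennreal (p (Suc i)) * ennreal (entropy_term s (Suc i) (p (Suc i)) / p (Suc i)))"
    by (rule nn_integral_bernoulli_digit[OF p, of "\<lambda>i. ennreal (entropy_term s i (p i) / p i)"])
  finally have I: "(\<integral>\<^sup>+a. ennreal (dim_potential p s a + digit_weight s p (a 0)) \<partial>?M)
     = (\<Sum>i. ennreal (p (Suc i)) * ennreal (entropy_term s (Suc i) (p (Suc i)) / p (Suc i)))
      + ennreal (2 * s) * (\<integral>\<^sup>+a. ennreal (cf_excess a) \<partial>?M)" .
  have "(\<Sum>i. ennreal (entropy_term s (Suc i) (p (Suc i))))
      = (\<Sum>i. ennreal (p (Suc i)) * ennreal (entropy_term s (Suc i) (p (Suc i)) / p (Suc i))) + (\<Sum>i. e i)"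
    unfolding ee[symmetric] by (intro suminf_add[symmetric] summableI)
  then show "energy s p = (\<integral>\<^sup>+a. ennreal (dim_potential p s a + digit_weight s p (a 0)) \<partial>?M) + (\<Sum>i. e i)"
    unfolding energy_def I by (simp add: ac_simps)
qed

lemma dim_potential_plus_weight_nonneg:
  assumes p: "p \<in> prob_vectors" and s: "0 < s"
  shows "AE a in bernoulli_measure p. 0 \<le> digit_weight s p (a 0)
    \<and> 0 \<le> dim_potential p s a + digit_weight s p (a 0)"
proof (rule AE_mp[OF AE_digit_pos[OF p]], intro AE_I2 impI)
  fix a assume a: "a \<in> space (bernoulli_measure p)" "\<forall>k. 0 < p (a k)"
  then have da: "\<forall>k. 1 \<le> a k" by (simp add: space_bernoulli_measure)
  have pa: "0 < p (a 0)" using a by simp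
  have "0 \<le> entropy_term s (a 0) (p (a 0)) / p (a 0)"
    using entropy_term_nonneg[of "a 0" "p (a 0)" s] da pa by (intro divide_nonneg_pos) auto
  then have "0 \<le> dim_potential p s a + digit_weight s p (a 0)"
    unfolding dim_potential_plus_weight[where a = a and p = p, OF da pa] using cf_excess_nonneg[OF da] s by simp
  then show "0 \<le> digit_weight s p (a 0) \<and> 0 \<le> dim_potential p s a + digit_weight s p (a 0)"
    using pa by (simp add: digit_weight_def)
qed

text \<open>
  By the upper bound for the dimension no truncation of the potential has a positive mean. Adding the
  integrable weight makes the truncations nonnegative, and monotone convergence gives the bound for
  the potential itself.
\<close>
lemma energy_le_zeta_sum:
  assumes p: "p \<in> prob_vectors" and s: "1 / 2 < s" and dim: "ennreal s < measure_dim (cf_measure p)"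
  shows "energy s p \<le> zeta_sum s"
proof -
  let ?M = "bernoulli_measure p"
  let ?X = "dim_potential p s" and ?W = "\<lambda>a. digit_weight s p (a 0)"
  interpret B: prob_space ?M by (rule prob_space_bernoulli_measure[OF p])
  obtain r where r: "r < \<infinity>" "energy s p = (\<integral>\<^sup>+a. ennreal (?X a + ?W a) \<partial>?M) + r"
    "zeta_sum s = (\<integral>\<^sup>+a. ennreal (?W a) \<partial>?M) + r"
    by (rule energy_split[OF p s])
  have s0: "0 < s" using s by simp
  note nonneg = dim_potential_plus_weight_nonneg[OF p s0]
  have [measurable]: "?W \<in> borel_measurable ?M" by measurable
  have "(\<integral>\<^sup>+a. ennreal (?W a) \<partial>?M) < \<infinity>"
    using zeta_sum_finite[OF s] unfolding r(3) by (simp add: ennreal_add_less_top)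
  then have W: "integrable ?M ?W"
    using nonneg by (intro integrableI_nonneg) auto
  have trunc: "(\<integral>\<^sup>+a. ennreal (min (?X a) (real n) + ?W a) \<partial>?M) \<le> (\<integral>\<^sup>+a. ennreal (?W a) \<partial>?M)" for n
  proof -
    have X: "integrable ?M (\<lambda>a. min (?X a) (real n))"
    proof (rule Bochner_Integration.integrable_bound)
      show "integrable ?M (\<lambda>a. ?W a + real n)" using W by simp
      show "AE a in ?M. norm (min (?X a) (real n)) \<le> norm (?W a + real n)"
        using nonneg by eventually_elim (auto simp: min_def)
    qed simp
    then have "(\<integral>a. min (?X a) (real n) \<partial>?M) \<le> 0"
      using measure_dim_le[OF p s0 X] dim by (meson leD not_le)
    then have "(\<integral>a. min (?X a) (real n) + ?W a \<partial>?M) \<le> (\<integral>a. ?W a \<partial>?M)"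
      using X W by simp
    moreover have "AE a in ?M. 0 \<le> min (?X a) (real n) + ?W a"
      using nonneg by eventually_elim (auto simp: min_def)
    moreover have "AE a in ?M. 0 \<le> ?W a" using nonneg by eventually_elim auto
    ultimately show ?thesis
      using X W by (simp add: nn_integral_eq_integral ennreal_leI)
  qed
  have "(\<integral>\<^sup>+a. ennreal (?X a + ?W a) \<partial>?M) \<le> (\<integral>\<^sup>+a. (SUP n. ennreal (min (?X a) (real n) + ?W a)) \<partial>?M)"
  proof (intro nn_integral_mono)
    fix a
    obtain n :: nat where "?X a \<le> real n" using real_arch_simple by blast
    then show "ennreal (?X a + ?W a) \<le> (SUP n. ennreal (min (?X a) (real n) + ?W a))"
      by (intro SUP_upper2[of n]) auto
  qed
  also have "\<dots> = (SUP n. \<integral>\<^sup>+a. ennreal (min (?X a) (real n) + ?W a) \<partial>?M)"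
    by (rule nn_integral_monotone_convergence_SUP)
       (auto simp: incseq_def le_fun_def intro!: ennreal_leI)
  also have "\<dots> \<le> (\<integral>\<^sup>+a. ennreal (?W a) \<partial>?M)"
    using trunc by (intro SUP_least)
  finally show ?thesis unfolding r by (rule add_right_mono)
qed

text \<open>
  Lowering the exponent from \<open>s\<close> to \<open>t\<close> keeps the entropy terms nonnegative and releases
  \<open>2 * (s - t) * p i * ln i\<close> from each of them. The bound is the same for all vectors, which is what
  makes a maximising sequence tight.
\<close>
lemma suminf_log_digits_le:
  assumes p: "p \<in> prob_vectors" and t: "1 / 2 < t" "t < s" and e: "energy s p \<le> zeta_sum s"
  shows "ennreal (2 * (s - t)) * (\<Sum>i. ennreal (p (Suc i) * ln (real (Suc i)))) \<le> zeta_sum s + zeta_sum t"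
proof -
  have p0: "0 \<le> p (Suc i)" for i using p by (simp add: prob_vectors_def)
  have "ennreal (2 * (s - t)) * (\<Sum>i. ennreal (p (Suc i) * ln (real (Suc i))))
      = (\<Sum>i. ennreal (2 * (s - t) * (p (Suc i) * ln (real (Suc i)))))"
    using t p0 by (subst ennreal_suminf_cmult[symmetric]) (simp add: ennreal_mult)
  also have "\<dots> \<le> (\<Sum>i. ennreal (entropy_term s (Suc i) (p (Suc i))) + ennreal (real (Suc i) powr (- 2 * t)))"
  proof (intro suminf_le)
    fix i
    have "0 \<le> entropy_term t (Suc i) (p (Suc i))" "0 \<le> entropy_term s (Suc i) (p (Suc i))"
      by (rule entropy_term_nonneg; use p0 in simp)+
    moreover have "entropy_term s (Suc i) (p (Suc i)) + real (Suc i) powr (- 2 * t)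
      = entropy_term t (Suc i) (p (Suc i)) + 2 * (s - t) * (p (Suc i) * ln (real (Suc i))) + real (Suc i) powr (- 2 * s)"
      by (simp add: entropy_term_def algebra_simps)
    ultimately have "2 * (s - t) * (p (Suc i) * ln (real (Suc i)))
      \<le> entropy_term s (Suc i) (p (Suc i)) + real (Suc i) powr (- 2 * t)"
      by (smt (verit) powr_ge_zero)
    then have "ennreal (2 * (s - t) * (p (Suc i) * ln (real (Suc i))))
      \<le> ennreal (entropy_term s (Suc i) (p (Suc i)) + real (Suc i) powr (- 2 * t))"
      by (rule ennreal_leI)
    also have "\<dots> = ennreal (entropy_term s (Suc i) (p (Suc i))) + ennreal (real (Suc i) powr (- 2 * t))"
      using \<open>0 \<le> entropy_term s (Suc i) (p (Suc i))\<close> by (intro ennreal_plus) auto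
    finally show "ennreal (2 * (s - t) * (p (Suc i) * ln (real (Suc i))))
      \<le> ennreal (entropy_term s (Suc i) (p (Suc i))) + ennreal (real (Suc i) powr (- 2 * t))" .
  qed auto
  also have "\<dots> = (\<Sum>i. ennreal (entropy_term s (Suc i) (p (Suc i)))) + zeta_sum t"
    unfolding zeta_sum_def by (intro suminf_add[symmetric] summableI)
  also have "\<dots> \<le> zeta_sum s + zeta_sum t"
    using e unfolding energy_def by (intro add_right_mono) (meson le_iff_add order_trans)
  finally show ?thesis .
qed

text \<open>
  The energy bound gives a finite logarithmic moment of the digits, hence integrability of all functions
  involved, and a mean potential at \<open>s\<close> that is at most \<open>0\<close>. Passing to the smaller exponent \<open>t\<close>
  subtracts a positive multiple of the mean of \<open>cf_log\<close> and makes the mean negative.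
\<close>
lemma measure_dim_ge_of_energy:
  assumes p: "p \<in> prob_vectors" and t: "1 / 2 < t" "t < s" and e: "energy s p \<le> zeta_sum s"
  shows "ennreal t \<le> measure_dim (cf_measure p)"
proof -
  let ?M = "bernoulli_measure p"
  let ?X = "dim_potential p s" and ?W = "\<lambda>a. digit_weight s p (a 0)"
  interpret B: prob_space ?M by (rule prob_space_bernoulli_measure[OF p])
  have s: "1 / 2 < s" using t by simp
  obtain r where r: "r < \<infinity>" "energy s p = (\<integral>\<^sup>+a. ennreal (?X a + ?W a) \<partial>?M) + r"
    "zeta_sum s = (\<integral>\<^sup>+a. ennreal (?W a) \<partial>?M) + r"
    by (rule energy_split[OF p s])
  have s0: "0 < s" using s by simp
  note nonneg = dim_potential_plus_weight_nonneg[OF p s0]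
  have nonneg': "AE a in ?M. 0 \<le> ?W a" "AE a in ?M. 0 \<le> ?X a + ?W a"
    using nonneg by (eventually_elim, auto)+
  have [measurable]: "?W \<in> borel_measurable ?M" by measurable
  have Wfin: "(\<integral>\<^sup>+a. ennreal (?W a) \<partial>?M) < \<infinity>"
    using zeta_sum_finite[OF s] unfolding r(3) by (simp add: ennreal_add_less_top)
  then have W: "integrable ?M ?W"
    using nonneg' by (intro integrableI_nonneg) auto
  have le: "(\<integral>\<^sup>+a. ennreal (?X a + ?W a) \<partial>?M) \<le> (\<integral>\<^sup>+a. ennreal (?W a) \<partial>?M)"
    using e r(1) unfolding r(2,3) by (auto simp: add.commute[of _ r] ennreal_add_left_cancel_le)
  then have XW: "integrable ?M (\<lambda>a. ?X a + ?W a)"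
    using nonneg' Wfin by (intro integrableI_nonneg) auto
  have X: "integrable ?M ?X"
    using Bochner_Integration.integrable_diff[OF XW W] by simp
  have "(\<integral>a. ?X a + ?W a \<partial>?M) \<le> (\<integral>a. ?W a \<partial>?M)"
    using le nonneg' W XW by (simp add: nn_integral_eq_integral integral_nonneg_AE)
  then have X0: "(\<integral>a. ?X a \<partial>?M) \<le> 0" using X W by simp

  have log_int: "integrable ?M cf_log"
  proof -
    have "ennreal (2 * (s - t)) * (\<Sum>i. ennreal (p (Suc i) * ln (real (Suc i)))) < \<infinity>"
      using suminf_log_digits_le[OF p t e] zeta_sum_finite[OF s] zeta_sum_finite[OF t(1)]
      by (auto simp: less_top[symmetric] top_unique)
    then have "(\<Sum>i. ennreal (p (Suc i) * ln (real (Suc i)))) < \<infinity>"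
      using t by (auto simp: ennreal_mult_less_top)
    moreover have "(\<integral>\<^sup>+a. ennreal (ln (real (a 0))) \<partial>?M) = (\<Sum>i. ennreal (p (Suc i) * ln (real (Suc i))))"
      unfolding nn_integral_bernoulli_digit[OF p, of "\<lambda>i. ennreal (ln (real i))"]
      using p by (simp add: ennreal_mult prob_vectors_def)
    ultimately have "integrable ?M (\<lambda>a. ln (real (a 0)))"
      by (intro integrableI_nonneg) (auto simp: space_bernoulli_measure intro!: AE_I2)
    then have "integrable ?M (\<lambda>a. ln (real (a 0)) + ln 2)" by simp
    then show ?thesis
    proof (rule Bochner_Integration.integrable_bound)
      show "AE a in ?M. norm (cf_log a) \<le> norm (ln (real (a 0)) + ln 2)"
      proof (rule AE_I2)
        fix a assume "a \<in> space ?M"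
        then have da: "\<forall>k. 1 \<le> a k" by (simp add: space_bernoulli_measure)
        then have a0: "1 \<le> real (a 0)" by simp
        have "cf_log a \<le> ln (real (a 0) * 2)"
        proof (rule order_trans[OF cf_log_bounds(2)[OF da]])
          show "ln (real (a 0) + 1) \<le> ln (real (a 0) * 2)" using a0 by simp
        qed
        then have "cf_log a \<le> ln (real (a 0)) + ln 2" using a0 by (simp add: ln_mult_pos)
        then show "norm (cf_log a) \<le> norm (ln (real (a 0)) + ln 2)"
          using cf_log_pos[OF da] by simp
      qed
    qed simp
  qed
  have "(\<integral>a. 0 \<partial>?M) < (\<integral>a. cf_log a \<partial>?M)"
  proof (rule B.integral_less_AE_space[OF _ log_int])
    show "AE a in ?M. 0 < cf_log a"
      by (intro AE_I2 cf_log_pos) (simp add: space_bernoulli_measure)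
    show "emeasure ?M (space ?M) \<noteq> 0"
      unfolding B.emeasure_space_1 by simp
  qed simp
  then have log_pos: "0 < (\<integral>a. cf_log a \<partial>?M)" by simp

  have Xt: "dim_potential p t = (\<lambda>a. ?X a - 2 * (s - t) * cf_log a)"
    by (simp add: dim_potential_def fun_eq_iff algebra_simps)
  show ?thesis
  proof (rule measure_dim_ge[OF p _ _ log_int])
    show "integrable ?M (dim_potential p t)"
      unfolding Xt using X log_int by simp
    have "(\<integral>a. dim_potential p t a \<partial>?M) = (\<integral>a. ?X a \<partial>?M) - 2 * (s - t) * (\<integral>a. cf_log a \<partial>?M)"
      unfolding Xt using X log_int by simp
    moreover have "0 < 2 * (s - t) * (\<integral>a. cf_log a \<partial>?M)" using t log_pos by simp
    ultimately show "(\<integral>a. dim_potential p t a \<partial>?M) < 0" using X0 by linarith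
  qed (use t in simp)
qed

section \<open>Lower semicontinuity of the energy\<close>

lemma ennreal_liminf_add_le:
  fixes u v :: "nat \<Rightarrow> ennreal"
  shows "liminf u + liminf v \<le> liminf (\<lambda>n. u n + v n)"
proof -
  have inc: "incseq (\<lambda>n. INF m\<in>{n..}. w m)" for w :: "nat \<Rightarrow> ennreal"
    by (auto simp: incseq_def intro!: INF_superset_mono)
  have "liminf u + liminf v = (SUP n. (INF m\<in>{n..}. u m) + (INF m\<in>{n..}. v m))"
    unfolding liminf_SUP_INF by (rule ennreal_SUP_add[symmetric]; rule inc)
  also have "\<dots> \<le> (SUP n. INF m\<in>{n..}. u m + v m)"
    by (intro SUP_mono' INF_greatest add_mono INF_lower) auto
  finally show ?thesis unfolding liminf_SUP_INF .
qed

lemma ennreal_liminf_mult_le: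
  fixes u v :: "nat \<Rightarrow> ennreal"
  shows "liminf u * liminf v \<le> liminf (\<lambda>n. u n * v n)"
proof -
  have "(INF j\<in>{n..}. u j) * (INF j\<in>{m..}. v j) \<le> (SUP k. INF j\<in>{k..}. u j * v j)" for n m
  proof (rule SUP_upper2[of "max n m"])
    show "(INF j\<in>{n..}. u j) * (INF j\<in>{m..}. v j) \<le> (INF j\<in>{max n m..}. u j * v j)"
      by (intro INF_greatest mult_mono INF_lower) auto
  qed simp
  then show ?thesis
    unfolding liminf_SUP_INF SUP_mult_right_ennreal[symmetric] SUP_mult_left_ennreal[symmetric]
    by (simp add: SUP_mult_right_ennreal SUP_mult_left_ennreal SUP_least)
qed

lemma suminf_liminf_le:
  fixes f :: "nat \<Rightarrow> nat \<Rightarrow> ennreal"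
  shows "(\<Sum>i. liminf (\<lambda>n. f n i)) \<le> liminf (\<lambda>n. \<Sum>i. f n i)"
  using nn_integral_liminf[of f "count_space UNIV"] by (simp add: nn_integral_count_space_nat)

text \<open>
  Induction on the number \<open>k\<close> of digits that matter: conditioning on the first digit turns the integral
  into a series of such integrals with \<open>k - 1\<close> digits, and Fatou's lemma handles the series.
\<close>
lemma nn_integral_bernoulli_liminf:
  fixes k :: nat
  assumes p: "p \<in> prob_vectors" and q: "\<And>n. q n \<in> prob_vectors"
    and lim: "\<And>i. (\<lambda>n. q n (Suc i)) \<longlonglongrightarrow> p (Suc i)"
    and meas: "\<And>r. G \<in> borel_measurable (bernoulli_measure r)"
    and dep: "\<And>a b. \<forall>j. 1 \<le> a j \<Longrightarrow> \<forall>j. 1 \<le> b j \<Longrightarrow> \<forall>j<k. a j = b j \<Longrightarrow> G a = G b"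
  shows "(\<integral>\<^sup>+a. G a \<partial>bernoulli_measure p) \<le> liminf (\<lambda>n. \<integral>\<^sup>+a. G a \<partial>bernoulli_measure (q n))"
  using meas dep
proof (induction k arbitrary: G)
  case 0
  have "(\<integral>\<^sup>+a. G a \<partial>bernoulli_measure r) = G (\<lambda>_. 1)" if r: "r \<in> prob_vectors" for r
  proof -
    interpret R: prob_space "bernoulli_measure r" by (rule prob_space_bernoulli_measure[OF r])
    have "(\<integral>\<^sup>+a. G a \<partial>bernoulli_measure r) = (\<integral>\<^sup>+a. G (\<lambda>_. 1) \<partial>bernoulli_measure r)"
      by (intro nn_integral_cong 0(2)) (auto simp: space_bernoulli_measure)
    then show ?thesis by (simp add: R.emeasure_space_1)
  qed
  then show ?case using p q by (simp add: Liminf_const)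
next
  case (Suc k)
  have cons: "(\<lambda>a. G (case_nat (Suc i) a)) \<in> borel_measurable (bernoulli_measure r)" for i r
  proof -
    have "(\<lambda>a. case_nat (Suc i) a) \<in> measurable (bernoulli_measure r) (bernoulli_measure r)"
      unfolding bernoulli_measure_def
    proof (rule measurable_PiM_single')
      fix j :: nat
      show "(\<lambda>a. case_nat (Suc i) a j) \<in> measurable (\<Pi>\<^sub>M n\<in>UNIV. digit_measure r) (digit_measure r)"
        by (cases j) (auto simp: digit_measure_def space_point_measure)
    next
      show "(\<lambda>a. case_nat (Suc i) a) \<in> space (\<Pi>\<^sub>M n\<in>UNIV. digit_measure r) \<rightarrow> (\<Pi>\<^sub>E j\<in>UNIV. space (digit_measure r))"
        by (auto simp: space_PiM digit_measure_def space_point_measure PiE_iff split: nat.split)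
    qed
    then show ?thesis using Suc.prems(1) by (rule measurable_compose)
  qed
  have "(\<integral>\<^sup>+a. G a \<partial>bernoulli_measure p)
      = (\<Sum>i. ennreal (p (Suc i)) * (\<integral>\<^sup>+a. G (case_nat (Suc i) a) \<partial>bernoulli_measure p))"
    by (rule nn_integral_bernoulli_first_digit[OF p Suc.prems(1)])
  also have "\<dots> \<le> (\<Sum>i. liminf (\<lambda>n. ennreal (q n (Suc i)) * (\<integral>\<^sup>+a. G (case_nat (Suc i) a) \<partial>bernoulli_measure (q n))))"
  proof (intro suminf_le)
    fix i
    let ?I = "\<lambda>r. \<integral>\<^sup>+a. G (case_nat (Suc i) a) \<partial>bernoulli_measure r"
    have IH: "?I p \<le> liminf (\<lambda>n. ?I (q n))"
    proof (rule Suc.IH)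
      fix a b :: "nat \<Rightarrow> nat" assume "\<forall>j. 1 \<le> a j" "\<forall>j. 1 \<le> b j" "\<forall>j<k. a j = b j"
      then show "G (case_nat (Suc i) a) = G (case_nat (Suc i) b)"
        by (intro Suc.prems(2)) (auto split: nat.split)
    qed (rule cons)
    have pl: "(\<lambda>n. ennreal (q n (Suc i))) \<longlonglongrightarrow> ennreal (p (Suc i))"
      by (intro tendsto_ennrealI lim)
    have "ennreal (p (Suc i)) * ?I p \<le> liminf (\<lambda>n. ennreal (q n (Suc i))) * liminf (\<lambda>n. ?I (q n))"
      by (intro mult_mono IH) (simp_all add: lim_imp_Liminf[OF _ pl])
    also have "\<dots> \<le> liminf (\<lambda>n. ennreal (q n (Suc i)) * ?I (q n))"
      by (rule ennreal_liminf_mult_le)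
    finally    show "ennreal (p (Suc i)) * ?I p \<le> liminf (\<lambda>n. ennreal (q n (Suc i)) * ?I (q n))" .
  qed auto
  also have "\<dots> \<le> liminf (\<lambda>n. \<Sum>i. ennreal (q n (Suc i)) * (\<integral>\<^sup>+a. G (case_nat (Suc i) a) \<partial>bernoulli_measure (q n)))"
    by (rule suminf_liminf_le)
  also have "\<dots> = liminf (\<lambda>n. \<integral>\<^sup>+a. G a \<partial>bernoulli_measure (q n))"
    using nn_integral_bernoulli_first_digit[OF q Suc.prems(1)] by simp
  finally show ?case .
qed


lemma tendsto_x_ln_x:
  fixes u :: "nat \<Rightarrow> real"
  assumes u: "u \<longlonglongrightarrow> c" and nonneg: "\<And>n. 0 \<le> u n"
  shows "(\<lambda>n. u n * ln (u n)) \<longlonglongrightarrow> c * ln c"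
proof (cases "c = 0")
  case False
  then show ?thesis by (intro tendsto_intros u)
next
  case True
  have "((\<lambda>x::real. x * ln x) \<longlongrightarrow> 0) (at_right 0)" by real_asymp
  then have "((\<lambda>x::real. x * ln x) \<longlongrightarrow> 0 * ln 0) (at 0 within {0..})"
    by (simp add: at_within_Ici_at_right)
  then have "continuous (at 0 within {0..}) (\<lambda>x::real. x * ln x)"
    by (simp add: continuous_within)
  from continuous_within_tendsto_compose[OF this, of u sequentially] show ?thesis
    using u nonneg True by simp
qed

lemma entropy_term_tendsto:
  assumes "u \<longlonglongrightarrow> c" "\<And>n::nat. 0 \<le> u n"
  shows "(\<lambda>n. entropy_term s i (u n)) \<longlonglongrightarrow> entropy_term s i c"
  unfolding entropy_term_def by (intro tendsto_intros tendsto_x_ln_x assms)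

text \<open>
  Lower bounds of \<open>cf_excess\<close> that depend on finitely many digits; \<open>2 * (1 / 2) ^ k\<close> is the error of
  truncating the continued fraction after \<open>k\<close> digits.
\<close>
definition excess_approx :: "nat \<Rightarrow> (nat \<Rightarrow> nat) \<Rightarrow> real" where
  "excess_approx k a = ln (1 + max 0 (cf_trunc (digit_shift a) k - 2 * (1 / 2) ^ k) / real (a 0))"

lemma cf_excess_eq:
  assumes a: "\<forall>k. 1 \<le> a k"
  shows "cf_excess a = ln (1 + cf_coding (digit_shift a) / real (a 0))"
proof -
  have a0: "0 < real (a 0)" using a by (simp add: Suc_le_eq)
  have "0 < cf_coding (digit_shift a)" by (rule cf_coding_bounds) (use a in simp)
  then have "cf_excess a = ln ((real (a 0) + cf_coding (digit_shift a)) / real (a 0))"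
    unfolding cf_excess_def cf_log_unfold[OF a] using a0 by (subst ln_div) auto
  then show ?thesis using a0 by (simp add: add_divide_distrib)
qed

lemma excess_approx_le:
  assumes a: "\<forall>k. 1 \<le> a k"
  shows "excess_approx k a \<le> cf_excess a"
proof -
  have s: "\<forall>k. 1 \<le> digit_shift a k" using a by simp
  have a0: "0 < real (a 0)" using a by (simp add: Suc_le_eq)
  have "(\<lambda>m. \<bar>cf_trunc (digit_shift a) k - cf_trunc (digit_shift a) (k + m)\<bar>)
      \<longlonglongrightarrow> \<bar>cf_trunc (digit_shift a) k - cf_coding (digit_shift a)\<bar>"
  proof (intro tendsto_intros)
    show "(\<lambda>m. cf_trunc (digit_shift a) (k + m)) \<longlonglongrightarrow> cf_coding (digit_shift a)"
      using LIMSEQ_ignore_initial_segment[OF cf_trunc_tendsto[OF s], of k] by (simp only: add.commute)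
  qed
  then have "\<bar>cf_trunc (digit_shift a) k - cf_coding (digit_shift a)\<bar> \<le> 2 * (1 / 2) ^ k"
    by (rule LIMSEQ_le_const2) (use cf_trunc_Cauchy_bound[OF s] in blast)
  then have "max 0 (cf_trunc (digit_shift a) k - 2 * (1 / 2) ^ k) \<le> cf_coding (digit_shift a)"
    using cf_coding_bounds(1)[OF s] by linarith
  then have "max 0 (cf_trunc (digit_shift a) k - 2 * (1 / 2) ^ k) / real (a 0) \<le> cf_coding (digit_shift a) / real (a 0)"
    using a0 by (intro divide_right_mono) auto
  then show ?thesis
    unfolding excess_approx_def cf_excess_eq[OF a] using a0
    by (intro ln_mono add_left_mono) (auto intro!: add_pos_nonneg divide_nonneg_pos)
qed

lemma excess_approx_tendsto:
  assumes a: "\<forall>k. 1 \<le> a k"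
  shows "(\<lambda>k. excess_approx k a) \<longlonglongrightarrow> cf_excess a"
proof -
  have s: "\<forall>k. 1 \<le> digit_shift a k" using a by simp
  have a0: "0 < real (a 0)" using a by (simp add: Suc_le_eq)
  have c: "0 < cf_coding (digit_shift a)" using cf_coding_bounds(1)[OF s] .
  have "(\<lambda>k. max 0 (cf_trunc (digit_shift a) k - 2 * (1 / 2) ^ k)) \<longlonglongrightarrow> max 0 (cf_coding (digit_shift a) - 2 * 0)"
    by (intro tendsto_intros cf_trunc_tendsto[OF s] LIMSEQ_realpow_zero) auto
  moreover have "1 + cf_coding (digit_shift a) / real (a 0) \<noteq> 0"
    using divide_pos_pos[OF c a0] by linarith
  ultimately show ?thesis
    unfolding excess_approx_def cf_excess_eq[OF a] using a0 c
    by (intro tendsto_intros) auto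
qed

lemma cf_trunc_cong: "\<forall>j<k. a j = b j \<Longrightarrow> cf_trunc a k = cf_trunc b k"
proof (induction k arbitrary: a b)
  case (Suc k)
  have "cf_trunc (digit_shift a) k = cf_trunc (digit_shift b) k"
    by (rule Suc.IH) (use Suc.prems in simp)
  then show ?case using Suc.prems by (simp add: cf_trunc_Suc_shift del: cf_trunc.simps)
qed simp

lemma measurable_excess_approx [measurable]:
  "excess_approx k \<in> borel_measurable (bernoulli_measure r)"
proof -
  have [measurable]: "(\<lambda>a. cf_trunc (digit_shift a) k) \<in> borel_measurable (bernoulli_measure r)"
    using measurable_cf_trunc[of 1 k r] by (simp add: digit_shift_def)
  show ?thesis unfolding excess_approx_def[abs_def] by measurable
qed

text \<open>
  Fatou's lemma is used twice: along the sequence of vectors for each finite approximation, and along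
  the approximations for the limit vector.
\<close>
lemma nn_integral_cf_excess_liminf:
  assumes p: "p \<in> prob_vectors" and q: "\<And>n. q n \<in> prob_vectors"
    and lim: "\<And>i. (\<lambda>n. q n (Suc i)) \<longlonglongrightarrow> p (Suc i)"
  shows "(\<integral>\<^sup>+a. ennreal (cf_excess a) \<partial>bernoulli_measure p)
    \<le> liminf (\<lambda>n. \<integral>\<^sup>+a. ennreal (cf_excess a) \<partial>bernoulli_measure (q n))"
proof -
  let ?L = "liminf (\<lambda>n. \<integral>\<^sup>+a. ennreal (cf_excess a) \<partial>bernoulli_measure (q n))"
  have approx: "(\<integral>\<^sup>+a. ennreal (excess_approx k a) \<partial>bernoulli_measure p) \<le> ?L" for k
  proof -
    have "(\<integral>\<^sup>+a. ennreal (excess_approx k a) \<partial>bernoulli_measure p)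
        \<le> liminf (\<lambda>n. \<integral>\<^sup>+a. ennreal (excess_approx k a) \<partial>bernoulli_measure (q n))"
    proof (rule nn_integral_bernoulli_liminf[OF p q lim, where k = "Suc k"])
      fix a b :: "nat \<Rightarrow> nat" assume eq: "\<forall>j<Suc k. a j = b j"
      have "cf_trunc (digit_shift a) k = cf_trunc (digit_shift b) k"
        by (rule cf_trunc_cong) (use eq in simp)
      then show "ennreal (excess_approx k a) = ennreal (excess_approx k b)"
        using eq by (simp add: excess_approx_def)
    qed measurable
    also have "\<dots> \<le> ?L"
      by (intro Liminf_mono always_eventually allI nn_integral_mono ennreal_leI excess_approx_le)
         (simp add: space_bernoulli_measure)
    finally show ?thesis .
  qed
  have "(\<integral>\<^sup>+a. ennreal (cf_excess a) \<partial>bernoulli_measure p)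
      = (\<integral>\<^sup>+a. liminf (\<lambda>k. ennreal (excess_approx k a)) \<partial>bernoulli_measure p)"
  proof (rule nn_integral_cong)
    fix a assume "a \<in> space (bernoulli_measure p)"
    then have "(\<lambda>k. ennreal (excess_approx k a)) \<longlonglongrightarrow> ennreal (cf_excess a)"
      by (intro tendsto_ennrealI excess_approx_tendsto) (simp add: space_bernoulli_measure)
    then show "ennreal (cf_excess a) = liminf (\<lambda>k. ennreal (excess_approx k a))"
      by (intro lim_imp_Liminf[symmetric]) auto
  qed
  also have "\<dots> \<le> liminf (\<lambda>k. \<integral>\<^sup>+a. ennreal (excess_approx k a) \<partial>bernoulli_measure p)"
    by (rule nn_integral_liminf) measurable
  also have "\<dots> \<le> liminf (\<lambda>k::nat. ?L)"
    by (intro Liminf_mono always_eventually allI approx)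
  also have "\<dots> = ?L" by (simp add: Liminf_const)
  finally show ?thesis .
qed

lemma energy_liminf:
  assumes p: "p \<in> prob_vectors" and q: "\<And>n. q n \<in> prob_vectors"
    and lim: "\<And>i. (\<lambda>n. q n (Suc i)) \<longlonglongrightarrow> p (Suc i)"
  shows "energy s p \<le> liminf (\<lambda>n. energy s (q n))"
proof -
  let ?e = "\<lambda>r i. ennreal (entropy_term s (Suc i) (r (Suc i)))"
  let ?I = "\<lambda>r. \<integral>\<^sup>+a. ennreal (cf_excess a) \<partial>bernoulli_measure r"
  have "(\<Sum>i. ?e p i) = (\<Sum>i. liminf (\<lambda>n. ?e (q n) i))"
  proof (intro suminf_cong lim_imp_Liminf[symmetric] tendsto_ennrealI entropy_term_tendsto lim)
    show "0 \<le> q n (Suc i)" for n i using q[of n] by (simp add: prob_vectors_def)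
  qed simp
  also have "\<dots> \<le> liminf (\<lambda>n. \<Sum>i. ?e (q n) i)" by (rule suminf_liminf_le)
  finally have 1: "(\<Sum>i. ?e p i) \<le> liminf (\<lambda>n. \<Sum>i. ?e (q n) i)" .
  have "ennreal (2 * s) * ?I p \<le> liminf (\<lambda>n::nat. ennreal (2 * s)) * liminf (\<lambda>n. ?I (q n))"
    by (simp add: Liminf_const mult_left_mono nn_integral_cf_excess_liminf[OF p q lim])
  also have "\<dots> \<le> liminf (\<lambda>n. ennreal (2 * s) * ?I (q n))"
    by (rule ennreal_liminf_mult_le)
  finally have 2: "ennreal (2 * s) * ?I p \<le> liminf (\<lambda>n. ennreal (2 * s) * ?I (q n))" .
  show ?thesis
    unfolding energy_def using add_mono[OF 1 2] ennreal_liminf_add_le by (rule order_trans)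
qed

section \<open>Compactness and existence of a maximiser\<close>

text \<open>
  The crude bound \<open>cf_log a \<le> ln (a 0 + 1)\<close> suggests weights proportional to \<open>1 / (i + 1)\<close>. On the
  digits \<open>1, 2, 3\<close> the normalising constant is \<open>1 / 2 + 1 / 3 + 1 / 4 = 13 / 12 > 1\<close>, so at exponent
  \<open>1 / 2\<close> the potential is at most \<open>- ln (13 / 12)\<close> almost surely, which leaves room for a slightly larger
  exponent.
\<close>
lemma exists_measure_dim_gt_half:
  obtains p s where "p \<in> prob_vectors" "1 / 2 < s" "ennreal s \<le> measure_dim (cf_measure p)"
proof -
  define p :: "nat \<Rightarrow> real" where "p i = (if i \<in> {1, 2, 3} then 12 / 13 / (real i + 1) else 0)" for i
  have p: "p \<in> prob_vectors"
  proof -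
    have "(\<lambda>i. p (Suc i)) sums (\<Sum>i<3. p (Suc i))"
      by (rule sums_finite) (auto simp: p_def)
    then show ?thesis
      by (simp add: prob_vectors_def p_def numeral_3_eq_3)
  qed
  define \<eta> :: real where "\<eta> = ln (13 / 12)"
  have \<eta>: "0 < \<eta>" by (simp add: \<eta>_def)
  define s where "s = 1 / 2 + \<eta> / (4 * ln 4)"
  have s: "1 / 2 < s" using \<eta> by (simp add: s_def)
  let ?M = "bernoulli_measure p"
  interpret B: prob_space ?M by (rule prob_space_bernoulli_measure[OF p])
  have bounds: "AE a in ?M. \<bar>cf_log a\<bar> \<le> ln 4 \<and> \<bar>dim_potential p s a\<bar> \<le> \<eta> + ln 4 + 2 * s * ln 4 \<and> dim_potential p s a \<le> - \<eta> / 2"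
  proof (rule AE_mp[OF AE_digit_pos[OF p]], intro AE_I2 impI)
    fix a assume a: "a \<in> space ?M" "\<forall>k. 0 < p (a k)"
    then have da: "\<forall>k. 1 \<le> a k" by (simp add: space_bernoulli_measure)
    have "0 < p (a 0)" using a by simp
    then have a0: "a 0 \<in> {1, 2, 3}" by (auto simp: p_def split: if_splits)
    then have L: "0 \<le> ln (real (a 0) + 1)" "ln (real (a 0) + 1) \<le> ln 4" by auto
    have "p (a 0) = (12 / 13) / (real (a 0) + 1)" using a0 by (auto simp: p_def)
    then have "ln (p (a 0)) = ln (12 / 13) - ln (real (a 0) + 1)"
      by (simp only:) (rule ln_divide_pos; simp)
    moreover have "ln (12 / 13 :: real) = - \<eta>"
      using ln_div[of 12 13] ln_div[of 13 12] by (simp add: \<eta>_def)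
    ultimately have lp: "ln (p (a 0)) = - \<eta> - ln (real (a 0) + 1)" by simp
    have Z: "0 < cf_log a" "cf_log a \<le> ln (real (a 0) + 1)"
      using cf_log_pos[OF da] cf_log_bounds(2)[OF da] by auto
    have sZ: "0 \<le> 2 * s * cf_log a" "2 * s * cf_log a \<le> 2 * s * ln (real (a 0) + 1)"
      using Z s by (auto intro!: mult_left_mono)
    have "2 * s * ln (real (a 0) + 1) \<le> 2 * s * ln 4"
      using L s by (intro mult_left_mono) auto
    then have b: "\<bar>dim_potential p s a\<bar> \<le> \<eta> + ln 4 + 2 * s * ln 4"
      using sZ L \<eta> unfolding dim_potential_def lp by linarith
    have "(2 * s - 1) * ln (real (a 0) + 1) \<le> (2 * s - 1) * ln 4"
      using L s by (intro mult_left_mono) auto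
    also have "(2 * s - 1) * ln 4 = \<eta> / 2" by (simp add: s_def)
    finally have "2 * s * ln (real (a 0) + 1) - ln (real (a 0) + 1) \<le> \<eta> / 2"
      by (simp add: algebra_simps)
    then have "dim_potential p s a \<le> - \<eta> / 2"
      using sZ unfolding dim_potential_def lp by linarith
    then show "\<bar>cf_log a\<bar> \<le> ln 4 \<and> \<bar>dim_potential p s a\<bar> \<le> \<eta> + ln 4 + 2 * s * ln 4 \<and> dim_potential p s a \<le> - \<eta> / 2"
      using b Z L by linarith
  qed
  have log_int: "integrable ?M cf_log"
    by (rule B.integrable_const_bound[of _ "ln 4"]) (use bounds in \<open>eventually_elim, auto\<close>)
  have X_int: "integrable ?M (dim_potential p s)"
    by (rule B.integrable_const_bound[of _ "\<eta> + ln 4 + 2 * s * ln 4"]) (use bounds in \<open>eventually_elim, auto\<close>)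
  have "(\<integral>a. dim_potential p s a \<partial>?M) \<le> (\<integral>a. - \<eta> / 2 \<partial>?M)"
  proof (rule integral_mono_AE[OF X_int])
    show "AE a in ?M. dim_potential p s a \<le> - \<eta> / 2" using bounds by eventually_elim auto
  qed simp
  also have "\<dots> < 0" using \<eta> by (simp add: B.prob_space)
  finally have "ennreal s \<le> measure_dim (cf_measure p)"
    by (intro measure_dim_ge[OF p _ X_int log_int]) (use s in auto)
  with p s show ?thesis by (rule that)
qed

lemma prob_vector_tail_le:
  assumes p: "p \<in> prob_vectors" and K: "0 \<le> K"
    and le: "(\<Sum>i. ennreal (p (Suc i) * ln (real (Suc i)))) \<le> ennreal K"
  shows "(1 - (\<Sum>i<N. p (Suc i))) * ln (real (Suc N)) \<le> K"
proof -
  have p0: "0 \<le> p (Suc i)" and sums: "(\<lambda>i. p (Suc i)) sums 1" for i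
    using p by (auto simp: prob_vectors_def)
  define f where "f i = p (Suc i) * ln (real (Suc i))" for i
  have f0: "0 \<le> f i" for i using p0 by (simp add: f_def)
  have fs: "summable f"
    by (rule summable_suminf_not_top[OF f0]) (use le in \<open>auto simp: f_def top_unique\<close>)
  have fK: "suminf f \<le> K"
  proof -
    have "ennreal (suminf f) \<le> ennreal K"
      using le unfolding f_def[symmetric] suminf_ennreal2[OF f0 fs] .
    then show ?thesis using K by simp
  qed
  have tail: "(\<lambda>i. p (Suc (i + N))) sums (1 - (\<Sum>i<N. p (Suc i)))"
    using sums_split_initial_segment[OF sums, of N] by simp
  have "(1 - (\<Sum>i<N. p (Suc i))) * ln (real (Suc N)) = (\<Sum>i. p (Suc (i + N)) * ln (real (Suc N)))"
    using sums_unique[OF sums_mult2[OF tail]] by simp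
  also have "\<dots> \<le> (\<Sum>i. f (i + N))"
  proof (rule suminf_le)
    show "p (Suc (i + N)) * ln (real (Suc N)) \<le> f (i + N)" for i
      unfolding f_def by (intro mult_left_mono p0) simp
    show "summable (\<lambda>i. p (Suc (i + N)) * ln (real (Suc N)))"
      using sums_mult2[OF tail] sums_summable by blast
    show "summable (\<lambda>i. f (i + N))" using fs by (simp add: summable_iff_shift)
  qed
  also have "\<dots> \<le> suminf f"
    using suminf_split_initial_segment[OF fs, of N] f0 by (simp add: sum_nonneg)
  finally show ?thesis using fK by simp
qed

text \<open>
  Tychonoff's theorem provides a pointwise limit along a subsequence. The common bound on the
  logarithmic moments keeps mass from escaping to infinity, so the limit has total mass \<open>1\<close>.
\<close>
lemma prob_vectors_compact:
  assumes q: "\<And>n. q n \<in> prob_vectors" and K: "0 \<le> K"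
    and le: "\<And>n. (\<Sum>i. ennreal (q n (Suc i) * ln (real (Suc i)))) \<le> ennreal K"
  obtains p r where "p \<in> prob_vectors" "strict_mono (r :: nat \<Rightarrow> nat)"
    "\<And>i. (\<lambda>n. q (r n) (Suc i)) \<longlonglongrightarrow> p (Suc i)"
proof -
  have q0: "0 \<le> q n (Suc i)" and sums: "(\<lambda>i. q n (Suc i)) sums 1" for n i
    using q[of n] by (auto simp: prob_vectors_def)
  have part: "(\<Sum>i<N. q n (Suc i)) \<le> 1" for n N
    using sum_le_suminf[OF sums_summable[OF sums], of "{..<N}" n] q0 sums_unique[OF sums, of n] by simp
  have q1: "q n (Suc i) \<le> 1" for n i
    using part[of n "Suc i"] sum_nonneg[of "{..<i}" "\<lambda>i. q n (Suc i)"] q0 by simp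
  have "compact (\<Pi>\<^sub>E i\<in>(UNIV :: nat set). {0..1 :: real})"
    using compactin_PiE[of "\<lambda>_::nat. euclidean :: real topology" UNIV "\<lambda>_. {0..1}"]
    by (simp add: euclidean_product_topology)
  then have "seq_compact (\<Pi>\<^sub>E i\<in>(UNIV :: nat set). {0..1 :: real})"
    by (simp add: compact_eq_seq_compact_metric)
  then obtain l r where r: "strict_mono (r :: nat \<Rightarrow> nat)" and l: "((\<lambda>n i. q n (Suc i)) \<circ> r) \<longlonglongrightarrow> l"
  proof -
    assume "seq_compact (\<Pi>\<^sub>E i\<in>(UNIV :: nat set). {0..1 :: real})"
    then show thesis
    proof (rule seq_compactE[where f = "\<lambda>n i. q n (Suc i)"])
      show "\<forall>n. (\<lambda>i. q n (Suc i)) \<in> (\<Pi>\<^sub>E i\<in>UNIV. {0..1})" using q0 q1 by auto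
    qed (use that in blast)
  qed
  have lim: "(\<lambda>n. q (r n) (Suc i)) \<longlonglongrightarrow> l i" for i
  proof -
    have "continuous_on UNIV (\<lambda>x::nat \<Rightarrow> real. x i)"
      by (rule continuous_on_product_coordinates)
    then have "isCont (\<lambda>x::nat \<Rightarrow> real. x i) l"
      using continuous_on_eq_continuous_at[OF open_UNIV] by blast
    from isCont_tendsto_compose[OF this l] show ?thesis by simp
  qed
  have l0: "0 \<le> l i" for i
    using lim[of i] by (rule LIMSEQ_le_const) (use q0 in blast)
  have plim: "(\<lambda>n. \<Sum>i<N. q (r n) (Suc i)) \<longlonglongrightarrow> (\<Sum>i<N. l i)" for N
    by (intro tendsto_sum lim)
  have l1: "(\<Sum>i<N. l i) \<le> 1" for N
    using plim by (rule LIMSEQ_le_const2) (use part in blast)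
  have lK: "(1 - (\<Sum>i<N. l i)) * ln (real (Suc N)) \<le> K" for N
  proof (rule LIMSEQ_le_const2)
    show "(\<lambda>n. (1 - (\<Sum>i<N. q (r n) (Suc i))) * ln (real (Suc N))) \<longlonglongrightarrow> (1 - (\<Sum>i<N. l i)) * ln (real (Suc N))"
      by (intro tendsto_intros plim)
  qed (use prob_vector_tail_le[OF q K le] in blast)
  have "l sums 1"
    unfolding sums_def
  proof (rule tendsto_sandwich[where h = "\<lambda>_. 1" and f = "\<lambda>N. 1 - K / ln (real (Suc N))"])
    show "eventually (\<lambda>N. 1 - K / ln (real (Suc N)) \<le> (\<Sum>i<N. l i)) sequentially"
    proof (rule eventually_sequentiallyI[of 1])
      fix N :: nat assume "1 \<le> N"
      then have "0 < ln (real (Suc N))" by simp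
      then show "1 - K / ln (real (Suc N)) \<le> (\<Sum>i<N. l i)"
        using lK[of N] by (simp add: field_simps)
    qed
    show "(\<lambda>N. 1 - K / ln (real (Suc N))) \<longlonglongrightarrow> 1" by real_asymp
  qed (use l1 in auto)
  then have "(\<lambda>i. l (i - 1)) \<in> prob_vectors"
    using l0 by (simp add: prob_vectors_def)
  then show ?thesis
    by (rule that[OF _ r]) (use lim in simp)
qed

theorem theorem1p2:
  shows "\<exists>p' \<in> prob_vectors.
           (SUP p\<in>prob_vectors. measure_dim (cf_measure p)) = measure_dim (cf_measure p')"
proof -
  let ?D = "\<lambda>p. measure_dim (cf_measure p)"
  define S where "S = (SUP p\<in>prob_vectors. ?D p)"
  obtain p0 s0 where p0: "p0 \<in> prob_vectors" "1 / 2 < s0" "ennreal s0 \<le> ?D p0"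
    by (rule exists_measure_dim_gt_half)
  have S0: "ennreal x < S" if "x < s0" for x
  proof -
    have "ennreal x < ennreal s0" using that p0(2) by (intro ennreal_lessI) auto
    also have "\<dots> \<le> ?D p0" by (rule p0(3))
    also have "\<dots> \<le> S" unfolding S_def by (rule SUP_upper[OF p0(1)])
    finally show ?thesis .
  qed
  have "?D ` prob_vectors \<noteq> {}" using p0 by blast
  from ennreal_Sup_countable_SUP[OF this, folded S_def]
  obtain f :: "nat \<Rightarrow> ennreal" where f: "incseq f" "range f \<subseteq> ?D ` prob_vectors" "S = (SUP n. f n)"
    by (elim exE conjE)
  have "\<exists>q. q \<in> prob_vectors \<and> f n = ?D q" for n
  proof -
    have "f n \<in> ?D ` prob_vectors" using f(2) by (rule subsetD) simp
    then show ?thesis by (elim imageE) (intro exI conjI)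
  qed
  then obtain q where "\<forall>n. q n \<in> prob_vectors \<and> f n = ?D (q n)"
    using choice[of "\<lambda>n q. q \<in> prob_vectors \<and> f n = ?D q"] by auto
  then have q: "\<And>n. q n \<in> prob_vectors" "\<And>n. f n = ?D (q n)" by auto
  have ev: "\<exists>N. \<forall>n\<ge>N. energy s (q n) \<le> zeta_sum s" if s: "1 / 2 < s" "ennreal s < S" for s
  proof -
    obtain N where N: "ennreal s < f N"
      using s(2) unfolding f(3) less_SUP_iff by blast
    have "energy s (q n) \<le> zeta_sum s" if "N \<le> n" for n
    proof (rule energy_le_zeta_sum[OF q(1) s(1)])
      show "ennreal s < ?D (q n)"
        using N incseqD[OF f(1) that] unfolding q(2)[symmetric] by (rule less_le_trans)
    qed
    then show ?thesis by blast
  qed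
  \<comment> \<open>Any \<open>1 / 2 < u < t < s0\<close> will do: \<open>t\<close> is eventually below the dimensions of the maximising sequence.\<close>
  define t where "t = (s0 + 1 / 2) / 2"
  define u where "u = (t + 1 / 2) / 2"
  have tu: "1 / 2 < t" "t < s0" "1 / 2 < u" "u < t"
    using p0(2) unfolding t_def u_def by (simp_all add: field_simps)
  obtain N where N: "\<And>n. N \<le> n \<Longrightarrow> energy t (q n) \<le> zeta_sum t"
    using ev[OF tu(1) S0[OF tu(2)]] by blast
  have "zeta_sum t + zeta_sum u < \<infinity>"
    using zeta_sum_finite tu by simp
  then obtain C where C: "0 \<le> C" "zeta_sum t + zeta_sum u = ennreal C"
    by (cases "zeta_sum t + zeta_sum u") auto
  define K where "K = C / (2 * (t - u))"
  have K: "0 \<le> K" using C tu by (simp add: K_def)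
  have bound: "(\<Sum>i. ennreal (q (n + N) (Suc i) * ln (real (Suc i)))) \<le> ennreal K" for n
  proof -
    let ?T = "\<Sum>i. ennreal (q (n + N) (Suc i) * ln (real (Suc i)))"
    have le: "ennreal (2 * (t - u)) * ?T \<le> ennreal C"
      using suminf_log_digits_le[OF q(1) tu(3,4) N, of "n + N"] unfolding C(2) by simp
    have "?T = ennreal (1 / (2 * (t - u))) * (ennreal (2 * (t - u)) * ?T)"
      using tu by (simp add: mult.assoc[symmetric] ennreal_mult[symmetric])
    also have "\<dots> \<le> ennreal (1 / (2 * (t - u))) * ennreal C"
      by (intro mult_left_mono le) simp
    also have "\<dots> = ennreal K"
      using tu C by (simp add: K_def ennreal_mult[symmetric])
    finally show ?thesis .
  qed
  obtain p r where p: "p \<in> prob_vectors" and r: "strict_mono (r :: nat \<Rightarrow> nat)"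
    and lim: "\<And>i. (\<lambda>n. q (r n + N) (Suc i)) \<longlonglongrightarrow> p (Suc i)"
  proof (rule prob_vectors_compact[of "\<lambda>n. q (n + N)", OF q(1) K bound])
    fix p and r :: "nat \<Rightarrow> nat"
    assume "p \<in> prob_vectors" "strict_mono r" "\<And>i. (\<lambda>n. q (r n + N) (Suc i)) \<longlonglongrightarrow> p (Suc i)"
    then show thesis by (rule that)
  qed
  have energy_p: "energy s p \<le> zeta_sum s" if s: "1 / 2 < s" "ennreal s < S" for s
  proof -
    obtain N' where N': "\<And>n. N' \<le> n \<Longrightarrow> energy s (q n) \<le> zeta_sum s"
      using ev[OF s] by blast
    have "energy s p \<le> liminf (\<lambda>n. energy s (q (r n + N)))"
      by (rule energy_liminf[OF p q(1) lim])
    also have "\<dots> \<le> liminf (\<lambda>n::nat. zeta_sum s)"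
    proof (intro Liminf_mono eventually_sequentiallyI)
      fix n assume "N' \<le> n"
      then have "N' \<le> r n + N" using seq_suble[OF r, of n] by linarith
      then show "energy s (q (r n + N)) \<le> zeta_sum s" by (rule N')
    qed
    finally show ?thesis by (simp add: Liminf_const)
  qed
  have "S \<le> ?D p"
  proof (rule dense_le)
    fix x assume x: "x < S"
    then obtain y where y: "x < y" "y < S" using dense by blast
    obtain a where a: "x = ennreal a" "0 \<le> a" using x by (cases x) auto
    obtain b where b: "y = ennreal b" "0 \<le> b" using y by (cases y) auto
    define s where "s = max b ((t + s0) / 2)"
    have "ennreal ((t + s0) / 2) < S" by (rule S0) (use tu in simp)
    then have s: "1 / 2 < s" "ennreal s < S"
      using y b tu by (auto simp: s_def max_def)
    have "a < b" using y a b by (simp add: ennreal_less_iff)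
    moreover have "t < (t + s0) / 2" using tu by simp
    ultimately have "max a t < s" unfolding s_def by linarith
    then have "ennreal (max a t) \<le> ?D p"
      using tu by (intro measure_dim_ge_of_energy[OF p _ _ energy_p[OF s]]) auto
    then show "x \<le> ?D p"
      unfolding a(1) by (rule order_trans[rotated]) (simp add: ennreal_leI)
  qed
  moreover have "?D p \<le> S" unfolding S_def using p by (rule SUP_upper)
  ultimately have "S = ?D p" by (rule antisym)
  then show ?thesis unfolding S_def using p by (rule bexI)
qed

end
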